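(* Let $m\ge 2$ and let $K\ne\Delta_{[m]}$ be a simplicial complex on $[m]$. Then $\mathrm{Bier}(K)$ is chordal if and only if $\mathrm{Bier}(K)$ is polytopal and one of the following holds: $m=2$ and $P_K=\Delta^1$; $m=3$ and $P_K=\Delta^2$ (a triangle); or $m\ge 4$ and $P_K$ is a truncation polytope of type $\mathrm{vc}^k(\Delta^{m-1})$ for some $0\le k\le m$.
   Context: A simplicial complex $K$ on $[m]=\{1,\dots,m\}$ is a nonempty family of subsets of $[m]$ closed under taking subsets. $\Delta_{[m]}=2^{[m]}$. Let $[m']=\{1',\dots,m'\}$ be a disjoint copy of $[m]$, $I'=\{i':i\in I\}$. For $K\ne\Delta_{[m]}$ the Alexander dual $K^\vee$ is the complex on $[m']$ with $J'\in K^\vee$ iff $[m]\setminus J\notin K$. The Bier sphere $\mathrm{Bier}(K)$ is the complex on $[m]\sqcup[m']$ with faces $I\sqcup J'$, $I\in K$, $J'\in K^\vee$, $I\cap J=\varnothing$; it is an $(m-2)$-dimensional PL sphere. $\mathrm{Bier}(K)$ is polytopal if it is simplicially isomorphic to the boundary complex of a convex simplicial polytope; then $P_K$ denotes a simple $(m-1)$-polytope whose dual $P_K^*$ has boundary complex isomorphic to $\mathrm{Bier}(K)$; equalities $P_K=Q$ mean combinatorial equivalence. A truncation polytope of type $\mathrm{vc}^k(\Delta^n)$ is a polytope combinatorially equivalent to a convex simple $n$-polytope obtained from the $n$-simplex $\Delta^n$ by a sequence of $k$ vertex truncations by hyperplanes in general position. A graph is chordal if it has no induced cycle of length greater than $3$;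 a simplicial complex is chordal if its 1-skeleton is a chordal graph. *)

theory Defs
  imports "HOL-Analysis.Analysis"
begin

text \<open>Vertices of [m] are encoded as Inl i, vertices of the copy [m'] as Inr i.\<close>

definition simplicial_complex_on :: "nat \<Rightarrow> nat set set \<Rightarrow> bool" where
  "simplicial_complex_on m K \<longleftrightarrow>
     K \<noteq> {} \<and> (\<forall>F\<in>K. F \<subseteq> {1..m}) \<and> (\<forall>F\<in>K. \<forall>G. G \<subseteq> F \<longrightarrow> G \<in> K)"

text \<open>Alexander dual, recorded by the un-primed index sets J (J' is Inr ` J).\<close>
definition alexander_dual :: "nat \<Rightarrow> nat set set \<Rightarrow> nat set set" where
  "alexander_dual m K = {J. J \<subseteq> {1..m} \<and> {1..m} - J \<notin> K}"

definition bier :: "nat \<Rightarrow> nat set set \<Rightarrow> (nat + nat) set set" where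
  "bier m K = {Inl ` I \<union> Inr ` J | I J.
                 I \<in> K \<and> J \<in> alexander_dual m K \<and> I \<inter> J = {}}"

definition adj :: "'v set set \<Rightarrow> 'v \<Rightarrow> 'v \<Rightarrow> bool" where
  "adj X u v \<longleftrightarrow> u \<noteq> v \<and> {u, v} \<in> X"

definition chordal_complex :: "'v set set \<Rightarrow> bool" where
  "chordal_complex X \<longleftrightarrow>
     \<not> (\<exists>cs. length cs \<ge> 4 \<and> distinct cs \<and>
           (\<forall>i < length cs. adj X (cs ! i) (cs ! ((i + 1) mod length cs))) \<and>
           (\<forall>i < length cs. \<forall>j < length cs. adj X (cs ! i) (cs ! j) \<longrightarrow>
                j = (i + 1) mod length cs \<or> i = (j + 1) mod length cs))"

definition simplicial_iso :: "'u set set \<Rightarrow> 'v set set \<Rightarrow> bool" where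
  "simplicial_iso X Y \<longleftrightarrow>
     (\<exists>f. bij_betw f (\<Union>X) (\<Union>Y) \<and> (\<forall>S. S \<subseteq> \<Union>X \<longrightarrow> (S \<in> X \<longleftrightarrow> f ` S \<in> Y)))"

definition boundary_complex :: "'a::real_vector set \<Rightarrow> 'a set set" where
  "boundary_complex P = {{v. v extreme_point_of F} | F. F face_of P \<and> F \<noteq> P}"

definition simplicial_polytope :: "'a::euclidean_space set \<Rightarrow> bool" where
  "simplicial_polytope P \<longleftrightarrow> polytope P \<and> (\<forall>F. F face_of P \<and> F \<noteq> P \<longrightarrow> (\<exists>n. n simplex F))"

definition polytopal :: "'a::euclidean_space itself \<Rightarrow> 'v set set \<Rightarrow> bool" where
  "polytopal (_ :: 'a itself) X \<longleftrightarrow>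
     (\<exists>P :: 'a set. simplicial_polytope P \<and> simplicial_iso X (boundary_complex P))"

text \<open>Boundary complex of the dual polytope Q^*: its vertices are the facets of Q, and its
  faces are the sets of facets containing a given nonempty face of Q.\<close>
definition dual_boundary_complex :: "'a::euclidean_space set \<Rightarrow> 'a set set set" where
  "dual_boundary_complex Q = {{F. F facet_of Q \<and> G \<subseteq> F} | G. G face_of Q \<and> G \<noteq> {}}"

text \<open>P_K = Q (combinatorially): Q is a polytope whose dual has boundary complex
  isomorphic to Bier(K).\<close>
definition PK_equiv :: "nat \<Rightarrow> nat set set \<Rightarrow> 'a::euclidean_space set \<Rightarrow> bool" where
  "PK_equiv m K Q \<longleftrightarrow> polytope Q \<and> simplicial_iso (bier m K) (dual_boundary_complex Q)"

inductive vertex_truncation :: "nat \<Rightarrow> nat \<Rightarrow> 'a::euclidean_space set \<Rightarrow> bool" where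
  base: "int n simplex P \<Longrightarrow> vertex_truncation n 0 P"
| step: "vertex_truncation n k P \<Longrightarrow> v extreme_point_of P \<Longrightarrow> a \<bullet> v > b \<Longrightarrow>
         (\<forall>w. w extreme_point_of P \<and> w \<noteq> v \<longrightarrow> a \<bullet> w < b) \<Longrightarrow>
         vertex_truncation n (Suc k) (P \<inter> {x. a \<bullet> x \<le> b})"

end

theory Submission
  imports Defs
begin

text \<open>
  Sending a point of a simple polytope to the set of facets through it turns the dual boundary
  complex into the family of all these sets. In these terms truncating a vertex \<open>v\<close> removes the
  face \<open>T\<close> of facets through \<open>v\<close> and adds a cone over its boundary, that is, it stacks a new
  vertex onto \<open>T\<close>. The neighbours of the new vertex form a clique, so in dimension at least 3 stacking preserves chordality.

  Conversely, if \<open>Bier(K)\<close> is chordal, then \<open>i, j', i', j\<close> is never an induced 4-cycle, and this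
  forces \<open>K\<close> or its Alexander dual to have no edges. As \<open>Bier(K)\<close> and \<open>Bier(K\<^sup>\<or>)\<close> agree up to
  swapping the two copies of \<open>[m]\<close>, one may take \<open>K\<close> to be a set of points. Adding a point
  \<open>i\<close> to \<open>K\<close> stacks \<open>Bier(K)\<close> on the facet \<open>([m] - i)'\<close>, starting from the boundary of
  a simplex, so \<open>Bier(K)\<close> is dual to a simplex truncated at some of its original vertices.
\<close>

section \<open>Simple polytopes given by inequalities\<close>

text \<open>Truncation and the dual boundary complex are defined through point sets, whose face
  lattices are awkward to track under cutting. Hence every polytope is carried with a system of
  labelled inequalities; each cut adds one label, and the family of tight sets stands in for the
  face lattice. The labels are arbitrary, so for the realization they can be chosen as the vertices
  of the Bier sphere itself: the family of tight sets is then equal to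
  \<open>bier m (points_complex A)\<close>, not merely isomorphic to it.

  The bound \<open>k \<le> m\<close> is the bound \<open>card A \<le> m\<close>: each point of the
  complex costs one cut. The split at \<open>m = 4\<close> comes from the size of the removed face.
  It has \<open>m - 1\<close> elements; if that is 2, stacking deletes an edge and lengthens a
  cycle, and only from 3 on does the old graph survive.

  For the implication from truncation polytopes to chordality the cuts may be at any vertex,
  including those created by earlier cuts. Knowing that the removed face is large enough then
  requires purity of the family as an invariant.\<close>

definition hpoly :: "'i set \<Rightarrow> ('i \<Rightarrow> 'a::euclidean_space) \<Rightarrow> ('i \<Rightarrow> real) \<Rightarrow> 'a set" where
  "hpoly I c d = {x. \<forall>i\<in>I. c i \<bullet> x \<le> d i}"

definition tight :: "'i set \<Rightarrow> ('i \<Rightarrow> 'a::euclidean_space) \<Rightarrow> ('i \<Rightarrow> real) \<Rightarrow> 'a \<Rightarrow> 'i set" where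
  "tight I c d x = {i\<in>I. c i \<bullet> x = d i}"

text \<open>For a maximal face \<open>T\<close> this is the stellar subdivision at \<open>T\<close>:
  only \<open>T\<close> itself is lost, and \<open>S = {}\<close> contributes the new vertex
  \<open>{z}\<close>.\<close>

definition stacked :: "'i \<Rightarrow> 'i set \<Rightarrow> 'i set set \<Rightarrow> 'i set set" where
  "stacked z T D = (D - {T}) \<union> {insert z S | S. S \<subset> T}"

text \<open>\<open>D\<close> records which constraints are simultaneously tight at a point. Its closure under subsets
  says that the polytope is simple, and the singletons in it that no constraint is redundant.\<close>
locale simple_hpoly =
  fixes I :: "'i set" and c :: "'i \<Rightarrow> 'a::euclidean_space" and d :: "'i \<Rightarrow> real" and D :: "'i set set"
  assumes fin: "finite I"
    and bdd: "bounded (hpoly I c d)"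
    and D_eq: "tight I c d ` hpoly I c d = D"
    and down: "T \<in> D \<Longrightarrow> S \<subseteq> T \<Longrightarrow> S \<in> D"
    and sing: "i \<in> I \<Longrightarrow> {i} \<in> D"
    and ne: "D \<noteq> {}"
begin

abbreviation "P \<equiv> hpoly I c d"
abbreviation "\<tau> \<equiv> tight I c d"

lemma D_sub: "T \<in> D \<Longrightarrow> T \<subseteq> I"
  using D_eq by (auto simp: tight_def)

lemma Union_D: "\<Union>D = I"
  using D_sub sing by blast

lemma D_point: "T \<in> D \<Longrightarrow> \<exists>x\<in>P. \<tau> x = T"
  using D_eq by blast

lemma tight_in_D: "x \<in> P \<Longrightarrow> \<tau> x \<in> D"
  using D_eq by blast

lemma empty_in_D: "{} \<in> D"
  using ne down by blast

lemma hpoly_Inter: "P = \<Inter>((\<lambda>i. {x. c i \<bullet> x \<le> d i}) ` I)"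
  by (auto simp: hpoly_def)

lemma polyhedron: "polyhedron P"
  unfolding hpoly_Inter using fin polyhedron_halfspace_le by (intro polyhedron_Inter) auto

lemma polytope: "polytope P"
  using bdd polyhedron polytope_eq_bounded_polyhedron by blast

lemma convex: "convex P" and compact: "compact P"
  using polytope by (simp_all add: polytope_imp_convex polytope_imp_compact)

text \<open>Slacks are affine and nonnegative on \<open>P\<close>, so at an inner point of a segment
  a slack vanishes exactly when it vanishes at both ends.\<close>

lemma tight_convex_combination:
  assumes "x \<in> P" "y \<in> P" "0 < t" "t < 1"
  shows "\<tau> ((1 - t) *\<^sub>R x + t *\<^sub>R y) = \<tau> x \<inter> \<tau> y"
proof -
  have "c i \<bullet> ((1 - t) *\<^sub>R x + t *\<^sub>R y) = d i \<longleftrightarrow> c i \<bullet> x = d i \<and> c i \<bullet> y = d i" if "i \<in> I" for i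
  proof -
    have le: "c i \<bullet> x \<le> d i" "c i \<bullet> y \<le> d i" using assms that by (auto simp: hpoly_def)
    define p where "p = d i - c i \<bullet> x"
    define q where "q = d i - c i \<bullet> y"
    have "d i - c i \<bullet> ((1 - t) *\<^sub>R x + t *\<^sub>R y) = (1 - t) * p + t * q"
      by (simp add: p_def q_def inner_add_right algebra_simps)
    moreover have "p \<ge> 0" "q \<ge> 0" using le by (simp_all add: p_def q_def)
    moreover have "(1 - t) * p \<ge> 0" "t * q \<ge> 0" using calculation assms by simp_all
    moreover have "(1 - t) * p + t * q = 0 \<longleftrightarrow> (1 - t) * p = 0 \<and> t * q = 0"
      using calculation(4,5) by (rule add_nonneg_eq_0_iff)
    moreover have "(1 - t) * p = 0 \<longleftrightarrow> p = 0" "t * q = 0 \<longleftrightarrow> q = 0"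
      using assms(3,4) by simp_all
    ultimately have "d i - c i \<bullet> ((1 - t) *\<^sub>R x + t *\<^sub>R y) = 0 \<longleftrightarrow> p = 0 \<and> q = 0" by argo
    then show ?thesis by (metis p_def q_def eq_iff_diff_eq_0)
  qed
  then show ?thesis by (auto simp: tight_def)
qed

lemma convex_comb_in:
  assumes "x \<in> P" "y \<in> P" "0 \<le> t" "t \<le> 1"
  shows "(1 - t) *\<^sub>R x + t *\<^sub>R y \<in> P"
  using convex assms by (simp add: convex_alt)

lemma small_step:
  "\<exists>e>0. \<forall>i\<in>I. c i \<bullet> x < d i \<longrightarrow> c i \<bullet> (x + e *\<^sub>R u) < d i"
proof -
  have "\<forall>i\<in>I. \<forall>\<^sub>F e in at_right 0. c i \<bullet> x < d i \<longrightarrow> c i \<bullet> (x + e *\<^sub>R u) < d i"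
  proof
    fix i assume "i \<in> I"
    have "((\<lambda>e. c i \<bullet> (x + e *\<^sub>R u)) \<longlongrightarrow> c i \<bullet> (x + 0 *\<^sub>R u)) (at_right 0)"
      by (intro tendsto_intros)
    then show "\<forall>\<^sub>F e in at_right 0. c i \<bullet> x < d i \<longrightarrow> c i \<bullet> (x + e *\<^sub>R u) < d i"
      using order_tendstoD(2)[of _ "c i \<bullet> x" _ "d i"] by (cases "c i \<bullet> x < d i") auto
  qed
  then have "\<forall>\<^sub>F e in at_right 0. \<forall>i\<in>I. c i \<bullet> x < d i \<longrightarrow> c i \<bullet> (x + e *\<^sub>R u) < d i"
    by (simp add: eventually_ball_finite fin)
  then have "\<forall>\<^sub>F e in at_right (0::real). e > 0 \<and> (\<forall>i\<in>I. c i \<bullet> x < d i \<longrightarrow> c i \<bullet> (x + e *\<^sub>R u) < d i)"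
    using eventually_at_right_less[of "0::real"] by eventually_elim auto
  then show ?thesis using eventually_happens[of _ "at_right (0::real)"] by auto
qed

text \<open>If \<open>x\<close> differed from \<open>v\<close>, the segment from \<open>x\<close>
  could be prolonged beyond \<open>v\<close>: constraints tight at \<open>v\<close> stay tight along
  that line, the others have room. In particular the tight set of a vertex is maximal in
  \<open>D\<close>.\<close>

lemma vertex_tight_unique:
  assumes v: "v extreme_point_of P" and x: "x \<in> P" and sub: "\<tau> v \<subseteq> \<tau> x"
  shows "x = v"
proof (rule ccontr)
  assume "x \<noteq> v"
  have vP: "v \<in> P" using v by (simp add: extreme_point_of_def)
  obtain e where e: "e > 0" "\<forall>i\<in>I. c i \<bullet> v < d i \<longrightarrow> c i \<bullet> (v + e *\<^sub>R (v - x)) < d i"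
    using small_step by blast
  define w where "w = v + e *\<^sub>R (v - x)"
  have wP: "w \<in> P" unfolding hpoly_def
  proof clarify
    fix i assume i: "i \<in> I"
    show "c i \<bullet> w \<le> d i"
    proof (cases "i \<in> \<tau> v")
      case True
      then have "c i \<bullet> v = d i" "c i \<bullet> x = d i" using sub by (auto simp: tight_def)
      then show ?thesis by (simp add: w_def inner_add_right inner_diff_right)
    next
      case False
      then have "c i \<bullet> v < d i" using i vP by (force simp: tight_def hpoly_def)
      then show ?thesis using e i by (fastforce simp: w_def)
    qed
  qed
  have "w \<noteq> x"
  proof
    assume "w = x"
    then have "(1 + e) *\<^sub>R (v - x) = 0" by (simp add: w_def algebra_simps)
    then show False using e \<open>x \<noteq> v\<close> by auto
  qed
  \<comment> \<open>Solving \<open>w = v + e (v - x)\<close> for \<open>v\<close> gives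
    \<open>v = (w + e x) / (1 + e)\<close>.\<close>
  moreover have "v = (1 - 1 / (1 + e)) *\<^sub>R x + (1 / (1 + e)) *\<^sub>R w"
  proof -
    have "(1 - 1 / (1 + e)) *\<^sub>R x + (1 / (1 + e)) *\<^sub>R w
        = (1 - 1 / (1 + e) - e / (1 + e)) *\<^sub>R x + (1 / (1 + e) + e / (1 + e)) *\<^sub>R v"
      by (simp add: w_def algebra_simps)
    moreover have "1 - 1 / (1 + e) - e / (1 + e) = 0" "1 / (1 + e) + e / (1 + e) = 1"
      using e by (simp_all add: field_simps)
    ultimately show ?thesis by simp
  qed
  ultimately have "v \<in> open_segment x w"
    using e by (subst in_segment) (auto intro!: exI[of _ "1 / (1 + e)"])
  then show False using v x wP by (auto simp: extreme_point_of_def)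
qed

text \<open>\<open>cell (\<tau> x)\<close> is the smallest face of \<open>P\<close> containing \<open>x\<close>.\<close>
definition cell :: "'i set \<Rightarrow> 'a set" where
  "cell T = {y \<in> P. T \<subseteq> \<tau> y}"

lemma cell_face: "cell T face_of P"
  unfolding face_of_def
proof (intro conjI ballI impI)
  show "cell T \<subseteq> P" by (auto simp: cell_def)
  show "convex (cell T)"
    unfolding convex_alt
  proof (intro ballI allI impI)
    fix x y and u :: real
    assume "x \<in> cell T" "y \<in> cell T" "0 \<le> u \<and> u \<le> 1"
    then show "(1 - u) *\<^sub>R x + u *\<^sub>R y \<in> cell T"
      using tight_convex_combination[of x y u] convex_comb_in[of x y u]
      by (cases "u = 0"; cases "u = 1") (auto simp: cell_def)
  qed
  fix x y z assume "x \<in> P" "y \<in> P" "z \<in> cell T" "z \<in> open_segment x y"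
  then obtain t where "0 < t" "t < 1" "z = (1 - t) *\<^sub>R x + t *\<^sub>R y"
    by (auto simp: in_segment)
  then show "x \<in> cell T" "y \<in> cell T"
    using \<open>z \<in> cell T\<close> \<open>x \<in> P\<close> \<open>y \<in> P\<close> by (auto simp: cell_def tight_convex_combination)
qed

text \<open>Krein-Milman for the face, whose extreme points are those of \<open>P\<close> lying in
  it. This is how information about vertices reaches arbitrary points.\<close>

lemma cell_eq_hull: "cell T = convex hull {w. w extreme_point_of P \<and> w \<in> cell T}"
proof -
  have "compact (cell T)" "convex (cell T)"
    using cell_face face_of_imp_compact face_of_imp_convex compact convex by blast+
  then have "cell T = convex hull {w. w extreme_point_of (cell T)}"
    by (rule Krein_Milman_Minkowski)
  then show ?thesis using extreme_point_of_face[OF cell_face] by simp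
qed

text \<open>Every tight set other than that of \<open>v\<close> survives the cut. The smallest face
  through \<open>x\<close> has a vertex \<open>w\<close> other than \<open>v\<close>, which lies
  below the cut; points near \<open>w\<close> on the way to \<open>x\<close> are still below it and
  have the tight set \<open>\<tau> w \<inter> \<tau> x = \<tau> x\<close>.\<close>

lemma truncated_representative:
  assumes v: "v extreme_point_of P" and w: "\<And>w. w extreme_point_of P \<Longrightarrow> w \<noteq> v \<Longrightarrow> a \<bullet> w < b"
    and x: "x \<in> P" "x \<noteq> v"
  shows "\<exists>y\<in>P. \<tau> y = \<tau> x \<and> a \<bullet> y < b"
proof -
  have "x \<in> cell (\<tau> x)" using x by (simp add: cell_def)
  have "\<exists>w. w extreme_point_of P \<and> w \<in> cell (\<tau> x) \<and> w \<noteq> v"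
  proof (rule ccontr)
    assume "\<not> ?thesis"
    then have "{w. w extreme_point_of P \<and> w \<in> cell (\<tau> x)} \<subseteq> {v}" by auto
    then have "convex hull {w. w extreme_point_of P \<and> w \<in> cell (\<tau> x)} \<subseteq> {v}"
      by (simp add: hull_minimal)
    then show False using \<open>x \<in> cell (\<tau> x)\<close> x(2) cell_eq_hull by auto
  qed
  then obtain w where we: "w extreme_point_of P" and wc: "w \<in> P" "\<tau> x \<subseteq> \<tau> w" and wv: "w \<noteq> v"
    by (auto simp: cell_def)
  have aw: "a \<bullet> w < b" using assms(2) we wv by blast
  have "((\<lambda>t. a \<bullet> ((1 - t) *\<^sub>R w + t *\<^sub>R x)) \<longlongrightarrow> a \<bullet> ((1 - 0) *\<^sub>R w + 0 *\<^sub>R x)) (at_right (0::real))"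
    by (intro tendsto_intros)
  then have "\<forall>\<^sub>F t in at_right 0. a \<bullet> ((1 - t) *\<^sub>R w + t *\<^sub>R x) < b"
    by (rule order_tendstoD) (use aw in simp)
  moreover have "\<forall>\<^sub>F t in at_right (0::real). 0 < t \<and> t < 1"
    unfolding eventually_at_right_field by (rule exI[of _ 1]) auto
  ultimately have "\<forall>\<^sub>F t in at_right (0::real). (0 < t \<and> t < 1) \<and> a \<bullet> ((1 - t) *\<^sub>R w + t *\<^sub>R x) < b"
    by eventually_elim auto
  then obtain t :: real where t: "0 < t" "t < 1" "a \<bullet> ((1 - t) *\<^sub>R w + t *\<^sub>R x) < b"
    using eventually_happens[of _ "at_right (0::real)"] by auto
  show ?thesis
  proof (intro bexI conjI)
    show "\<tau> ((1 - t) *\<^sub>R w + t *\<^sub>R x) = \<tau> x"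
      using tight_convex_combination[OF wc(1) x(1) t(1,2)] wc(2) by auto
    show "(1 - t) *\<^sub>R w + t *\<^sub>R x \<in> P" using convex_comb_in wc x t by simp
  qed (fact t(3))
qed

text \<open>If the smallest face through \<open>x\<close> missed \<open>v\<close>, all its vertices,
  hence also \<open>x\<close>, would lie strictly below the cut.\<close>

lemma tight_on_cut:
  assumes v: "v extreme_point_of P" "a \<bullet> v > b"
    and w: "\<And>w. w extreme_point_of P \<Longrightarrow> w \<noteq> v \<Longrightarrow> a \<bullet> w < b"
    and x: "x \<in> P" "a \<bullet> x = b"
  shows "\<tau> x \<subset> \<tau> v"
proof -
  have xc: "x \<in> cell (\<tau> x)" using x by (simp add: cell_def)
  have "v \<in> cell (\<tau> x)"
  proof (rule ccontr)
    assume "v \<notin> cell (\<tau> x)"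
    then have "{w. w extreme_point_of P \<and> w \<in> cell (\<tau> x)} \<subseteq> {y. a \<bullet> y < b}" using w by auto
    then have "convex hull {w. w extreme_point_of P \<and> w \<in> cell (\<tau> x)} \<subseteq> {y. a \<bullet> y < b}"
      by (simp add: hull_minimal convex_halfspace_lt)
    then show False using xc x cell_eq_hull by auto
  qed
  then have "\<tau> x \<subseteq> \<tau> v" by (simp add: cell_def)
  moreover have "\<tau> x \<noteq> \<tau> v" using vertex_tight_unique[OF v(1) x(1)] v(2) x(2) by auto
  ultimately show ?thesis by blast
qed

text \<open>A point with tight set \<open>T\<close> below the cut is joined to \<open>v\<close>; the
  segment crosses the hyperplane at an inner point, where the tight set is
  \<open>T \<inter> \<tau> v = T\<close>.\<close>

lemma cut_realizes_proper_subset: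
  assumes v: "v extreme_point_of P" "a \<bullet> v > b"
    and w: "\<And>w. w extreme_point_of P \<Longrightarrow> w \<noteq> v \<Longrightarrow> a \<bullet> w < b"
    and T: "T \<subset> \<tau> v"
  shows "\<exists>x\<in>P. a \<bullet> x = b \<and> \<tau> x = T"
proof -
  have vP: "v \<in> P" using v by (simp add: extreme_point_of_def)
  obtain x where x: "x \<in> P" "\<tau> x = T" using D_point down tight_in_D[OF vP] T by blast
  then obtain y where y: "y \<in> P" "\<tau> y = T" "a \<bullet> y < b"
    using truncated_representative[OF v(1) w, of x] T by blast
  \<comment> \<open>The parameter at which the segment from \<open>y\<close> to \<open>v\<close>
    meets the hyperplane.\<close>
  define t where "t = (b - a \<bullet> y) / (a \<bullet> v - a \<bullet> y)"
  have t: "0 < t" "t < 1" using y v by (auto simp: t_def)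
  have "t * (a \<bullet> v - a \<bullet> y) = b - a \<bullet> y" using y v by (simp add: t_def)
  then have "a \<bullet> ((1 - t) *\<^sub>R y + t *\<^sub>R v) = b"
    by (simp add: inner_add_right algebra_simps)
  moreover have "\<tau> ((1 - t) *\<^sub>R y + t *\<^sub>R v) = T"
    using tight_convex_combination[OF y(1) vP t] y T by auto
  ultimately show ?thesis using convex_comb_in[OF y(1) vP] t by (intro bexI conjI) auto
qed

text \<open>The geometric half of stacking. Points of the cut polytope off the hyperplane keep an
  old tight set other than \<open>\<tau> v\<close>; points on it show \<open>z\<close> together with
  a proper subset of \<open>\<tau> v\<close>. The bound on \<open>card (\<tau> v)\<close> keeps the
  removed face from being a singleton, so no old constraint becomes redundant.\<close>

lemma truncation:
  assumes v: "v extreme_point_of P" "a \<bullet> v > b"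
    and w: "\<And>w. w extreme_point_of P \<Longrightarrow> w \<noteq> v \<Longrightarrow> a \<bullet> w < b"
    and z: "z \<notin> I" and card: "card (\<tau> v) \<ge> 2"
  shows "simple_hpoly (insert z I) (c(z := a)) (d(z := b)) (stacked z (\<tau> v) D)"
    and "hpoly (insert z I) (c(z := a)) (d(z := b)) = P \<inter> {x. a \<bullet> x \<le> b}"
proof -
  let ?P = "hpoly (insert z I) (c(z := a)) (d(z := b))"
  let ?t = "tight (insert z I) (c(z := a)) (d(z := b))"
  show P': "?P = P \<inter> {x. a \<bullet> x \<le> b}"
    using z by (auto simp: hpoly_def)
  have t': "?t x = (if a \<bullet> x = b then insert z (\<tau> x) else \<tau> x)" for x
    using z by (auto simp: tight_def)
  have vP: "v \<in> P" using v by (simp add: extreme_point_of_def)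
  have TD: "\<tau> v \<in> D" using tight_in_D vP .
  have T_I: "\<tau> v \<subseteq> I" by (auto simp: tight_def)
  show "simple_hpoly (insert z I) (c(z := a)) (d(z := b)) (stacked z (\<tau> v) D)"
  proof
    show "finite (insert z I)" using fin by simp
    show "bounded ?P" unfolding P' using bdd by (simp add: bounded_Int)
    show "?t ` ?P = stacked z (\<tau> v) D"
    proof
      show "?t ` ?P \<subseteq> stacked z (\<tau> v) D"
      proof (rule image_subsetI)
        fix x assume "x \<in> ?P"
        then have x: "x \<in> P" "a \<bullet> x \<le> b" using P' by auto
        show "?t x \<in> stacked z (\<tau> v) D"
        proof (cases "a \<bullet> x = b")
          case True
          then have "\<tau> x \<subset> \<tau> v" using tight_on_cut[OF v w x(1)] by blast
          then show ?thesis using True by (auto simp: t' stacked_def)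
        next
          case False
          have "\<tau> x \<noteq> \<tau> v" using vertex_tight_unique[OF v(1) x(1)] v(2) x(2) by auto
          then show ?thesis using False tight_in_D[OF x(1)] by (auto simp: t' stacked_def)
        qed
      qed
      show "stacked z (\<tau> v) D \<subseteq> ?t ` ?P"
      proof
        fix S assume "S \<in> stacked z (\<tau> v) D"
        then consider "S \<in> D" "S \<noteq> \<tau> v" | R where "S = insert z R" "R \<subset> \<tau> v"
          by (auto simp: stacked_def)
        then show "S \<in> ?t ` ?P"
        proof cases
          case 1
          then obtain x where x: "x \<in> P" "\<tau> x = S" using D_point by blast
          then obtain y where "y \<in> P" "\<tau> y = S" "a \<bullet> y < b"
            using truncated_representative[OF v(1) w, of x] 1 by blast
          then show ?thesis using P' t'[of y] by (intro image_eqI[of _ _ y]) auto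
        next
          case 2
          then obtain x where "x \<in> P" "a \<bullet> x = b" "\<tau> x = R"
            using cut_realizes_proper_subset[OF v w] by blast
          then show ?thesis using P' t'[of x] 2 by (intro image_eqI[of _ _ x]) auto
        qed
      qed
    qed
    show "S \<in> stacked z (\<tau> v) D" if T: "T \<in> stacked z (\<tau> v) D" and S: "S \<subseteq> T" for S T
      using T unfolding stacked_def
    proof (elim UnE)
      assume "T \<in> D - {\<tau> v}"
      \<comment> \<open>The removed face is maximal, so it is not below any face that is
        kept.\<close>
      moreover have "S \<noteq> \<tau> v"
      proof
        assume "S = \<tau> v"
        then obtain x where "x \<in> P" "\<tau> x = T" using D_point calculation by blast
        then show False
          using vertex_tight_unique[OF v(1)] S \<open>S = \<tau> v\<close> calculation by blast
      qed
      ultimately show "S \<in> D - {\<tau> v} \<union> {insert z S |S. S \<subset> \<tau> v}" using down S by blast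
    next
      assume "T \<in> {insert z S |S. S \<subset> \<tau> v}"
      then obtain R where R: "T = insert z R" "R \<subset> \<tau> v" by blast
      show "S \<in> D - {\<tau> v} \<union> {insert z S |S. S \<subset> \<tau> v}"
      proof (cases "z \<in> S")
        case True
        then have "S = insert z (S - {z})" "S - {z} \<subset> \<tau> v" using R S by auto
        then show ?thesis by blast
      next
        case False
        then have "S \<subset> \<tau> v" using R S by blast
        then show ?thesis using down TD by blast
      qed
    qed
    show "{i} \<in> stacked z (\<tau> v) D" if "i \<in> insert z I" for i
    proof (cases "i = z")
      case True
      have "{} \<subset> \<tau> v" using card by force
      then show ?thesis using True by (auto simp: stacked_def)
    next
      case False
      then have "{i} \<in> D" using sing that by simp
      moreover have "{i} \<noteq> \<tau> v" using card by (metis card.empty card_insert_disjoint empty_iff finite.emptyI not_less_eq_eq numeral_2_eq_2 order_refl)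
      ultimately show ?thesis by (auto simp: stacked_def)
    qed
    show "stacked z (\<tau> v) D \<noteq> {}"
      using empty_in_D card by (fastforce simp: stacked_def)
  qed
qed

text \<open>The nonempty face \<open>cell T\<close> has an extreme point; its tight set contains
  \<open>T\<close> and equals it by maximality.\<close>

lemma vertex_exists:
  assumes "T \<in> D" "\<And>S. S \<in> D \<Longrightarrow> T \<subseteq> S \<Longrightarrow> S = T"
  shows "\<exists>v. v extreme_point_of P \<and> \<tau> v = T"
proof -
  obtain x where x: "x \<in> P" "\<tau> x = T" using D_point assms by blast
  then have "x \<in> cell T" by (simp add: cell_def)
  then have "{w. w extreme_point_of P \<and> w \<in> cell T} \<noteq> {}" using cell_eq_hull[of T] by force
  then obtain w where "w extreme_point_of P" "w \<in> P" "T \<subseteq> \<tau> w" by (auto simp: cell_def)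
  then show ?thesis using assms(2) tight_in_D by blast
qed

text \<open>The vertex \<open>v\<close> is not in the hull \<open>W\<close> of the others, since it
  would be extreme there and so be one of the generators. Strict separation from this compact set
  gives the cut, after a change of sign.\<close>

lemma truncating_halfspace_exists:
  assumes v: "v extreme_point_of P"
  shows "\<exists>a b. a \<bullet> v > b \<and> (\<forall>w. w extreme_point_of P \<and> w \<noteq> v \<longrightarrow> a \<bullet> w < b)"
proof -
  define W where "W = {w. w extreme_point_of P} - {v}"
  have "finite W" unfolding W_def using finite_polyhedron_extreme_points[OF polyhedron] by simp
  have sub: "convex hull W \<subseteq> P"
    using convex by (intro hull_minimal) (auto simp: W_def extreme_point_of_def)
  have "v \<notin> convex hull W"
  proof
    assume "v \<in> convex hull W"
    then have "v extreme_point_of (convex hull W)"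
      using v sub unfolding extreme_point_of_def by blast
    then show False using extreme_point_of_convex_hull W_def by fastforce
  qed
  then obtain a b where "a \<bullet> v < b" "\<forall>x\<in>convex hull W. a \<bullet> x > b"
    using separating_hyperplane_closed_point[of "convex hull W" v] \<open>finite W\<close>
    by (auto simp: finite_imp_compact_convex_hull compact_imp_closed)
  then have "(-a) \<bullet> v > -b" "\<forall>w\<in>W. (-a) \<bullet> w < -b" by (auto simp: hull_inc)
  then show ?thesis unfolding W_def by blast
qed

section \<open>Facets and the dual boundary complex\<close>

lemma normal_nonzero: "i \<in> I \<Longrightarrow> c i \<noteq> 0"
proof
  assume i: "i \<in> I" "c i = 0"
  obtain x where "\<tau> x = {i}" using D_point sing i by blast
  then have "i \<in> \<tau> x" by simp
  moreover obtain y where "\<tau> y = {}" using D_point empty_in_D by blast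
  ultimately show False using i by (auto simp: tight_def)
qed

text \<open>A point tight at \<open>i\<close> only is pushed outwards along the normal
  \<open>c i\<close>. The result certifies that constraint \<open>i\<close> is irredundant.\<close>

lemma point_beyond:
  assumes "i \<in> I"
  shows "\<exists>y. c i \<bullet> y > d i \<and> (\<forall>j\<in>I - {i}. c j \<bullet> y < d j)"
proof -
  obtain x where x: "x \<in> P" "\<tau> x = {i}" using D_point sing assms by blast
  obtain e where e: "e > 0" "\<forall>j\<in>I. c j \<bullet> x < d j \<longrightarrow> c j \<bullet> (x + e *\<^sub>R c i) < d j"
    using small_step by blast
  have "c j \<bullet> x < d j" if "j \<in> I - {i}" for j
    using x that by (force simp: tight_def hpoly_def)
  moreover have "i \<in> \<tau> x" using x by simp
  then have "c i \<bullet> (x + e *\<^sub>R c i) > d i"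
    using e normal_nonzero[OF assms] by (auto simp: tight_def inner_add_right)
  ultimately show ?thesis using e by blast
qed

lemma affine_hull_P: "affine hull P = UNIV"
proof -
  obtain y where y: "y \<in> P" "\<tau> y = {}" using D_point empty_in_D by blast
  define U where "U = (\<Inter>i\<in>I. {x. c i \<bullet> x < d i})"
  have "open U" unfolding U_def using fin by (intro open_INT) (auto simp: open_halfspace_lt)
  moreover have "y \<in> U" using y by (force simp: U_def tight_def hpoly_def)
  moreover have "U \<subseteq> P" by (force simp: U_def hpoly_def)
  ultimately have "interior P \<noteq> {}" using interior_maximal by blast
  then show ?thesis by (rule affine_hull_nonempty_interior)
qed

definition facet :: "'i \<Rightarrow> 'a set" where
  "facet i = P \<inter> {x. c i \<bullet> x = d i}"

lemma facets: "G facet_of P \<longleftrightarrow> G \<in> facet ` I"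
proof -
  \<comment> \<open>The library characterization of facets takes a minimal set of half-spaces, not
    an indexed family. So \<open>H\<close> has to be injective, and \<open>k\<close> recovers the
    index from the half-space.\<close>
  define H where "H i = {x. c i \<bullet> x \<le> d i}" for i
  have inj: "inj_on H I"
  proof (rule inj_onI, rule ccontr)
    fix i j assume ij: "i \<in> I" "j \<in> I" "H i = H j" "i \<noteq> j"
    obtain y where "c i \<bullet> y > d i" "\<forall>j\<in>I - {i}. c j \<bullet> y < d j" using point_beyond ij by blast
    then have "d i < c i \<bullet> y" "c j \<bullet> y < d j" using ij by auto
    then have "y \<in> H j - H i" by (simp add: H_def)
    then show False using ij by simp
  qed
  define k where "k = inv_into I H"
  have k: "k (H i) = i" if "i \<in> I" for i using inj that by (simp add: k_def)
  have "G facet_of P \<longleftrightarrow> (\<exists>h. h \<in> H ` I \<and> G = P \<inter> {x. c (k h) \<bullet> x = d (k h)})"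
  proof (rule facet_of_polyhedron_explicit)
    show "finite (H ` I)" using fin by simp
    show "P = affine hull P \<inter> \<Inter>(H ` I)" unfolding affine_hull_P by (auto simp: hpoly_def H_def)
    show "c (k h) \<noteq> 0 \<and> h = {x. c (k h) \<bullet> x \<le> d (k h)}" if "h \<in> H ` I" for h
      using that k normal_nonzero by (auto simp: H_def)
    show "P \<subset> affine hull P \<inter> \<Inter>F'" if "F' \<subset> H ` I" for F'
    proof -
      obtain i where i: "i \<in> I" "H i \<notin> F'" using \<open>F' \<subset> H ` I\<close> by blast
      obtain y where y: "c i \<bullet> y > d i" "\<forall>j\<in>I - {i}. c j \<bullet> y < d j" using point_beyond i by blast
      have "y \<in> \<Inter>F'"
      proof
        fix h assume "h \<in> F'"
        then have "h \<in> H ` I" using that by blast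
        then obtain j where j: "j \<in> I" "h = H j" by blast
        then have "j \<in> I - {i}" using i \<open>h \<in> F'\<close> by auto
        then have "c j \<bullet> y < d j" using y by blast
        then show "y \<in> h" by (simp add: H_def j)
      qed
      moreover have "y \<notin> P" using y i by (auto simp: hpoly_def not_le)
      moreover have "P = \<Inter>(H ` I)" by (auto simp: hpoly_def H_def)
      then have "P \<subseteq> \<Inter>F'" using that by (simp add: Inter_anti_mono)
      ultimately show ?thesis unfolding affine_hull_P by blast
    qed
  qed
  also have "\<dots> \<longleftrightarrow> G \<in> facet ` I" using k by (auto simp: facet_def)
  finally show ?thesis .
qed

lemma facet_inj: "inj_on facet I"
proof (rule inj_onI)
  fix i j assume ij: "i \<in> I" "j \<in> I" "facet i = facet j"
  obtain x where x: "x \<in> P" "\<tau> x = {i}" using D_point sing ij by blast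
  then have "x \<in> facet i" by (auto simp: facet_def tight_def)
  then have "j \<in> \<tau> x" using ij by (auto simp: facet_def tight_def)
  then show "i = j" using x by simp
qed

text \<open>A facet meeting the relative interior of \<open>G\<close> contains all of
  \<open>G\<close>, so one relative interior point decides which facets contain the face.\<close>

lemma facets_containing_face:
  assumes "G face_of P" and x: "x \<in> rel_interior G"
  shows "{F. F facet_of P \<and> G \<subseteq> F} = facet ` \<tau> x"
proof -
  have xG: "x \<in> G" using x rel_interior_subset by blast
  have GP: "G \<subseteq> P" using assms by (simp add: face_of_imp_subset)
  have "G \<subseteq> facet i \<longleftrightarrow> i \<in> \<tau> x" if i: "i \<in> I" for i
  proof
    assume "G \<subseteq> facet i" then show "i \<in> \<tau> x" using xG i by (auto simp: facet_def tight_def)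
  next
    assume "i \<in> \<tau> x"
    then have "x \<in> facet i" using xG GP by (auto simp: facet_def tight_def)
    moreover have "facet i face_of P" using facets i facet_of_imp_face_of by blast
    ultimately show "G \<subseteq> facet i" using subset_of_face_of[of "facet i" P G] GP x by blast
  qed
  then show ?thesis using facets by (auto simp: tight_def)
qed

text \<open>A nonempty face contributes the tight set of any of its relative interior points;
  conversely the tight set of \<open>x\<close> is contributed by the face
  \<open>cell (\<tau> x)\<close>.\<close>

lemma dual_boundary: "dual_boundary_complex P = image facet ` D"
proof
  show "dual_boundary_complex P \<subseteq> image facet ` D"
  proof
    fix X assume "X \<in> dual_boundary_complex P"
    then obtain G where G: "X = {F. F facet_of P \<and> G \<subseteq> F}" "G face_of P" "G \<noteq> {}"
      by (auto simp: dual_boundary_complex_def)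
    then obtain x where x: "x \<in> rel_interior G"
      using rel_interior_eq_empty face_of_imp_convex by blast
    then have "x \<in> P" using G rel_interior_subset face_of_imp_subset by blast
    then show "X \<in> image facet ` D" using facets_containing_face[OF G(2) x] G tight_in_D by blast
  qed
  show "image facet ` D \<subseteq> dual_boundary_complex P"
  proof
    fix X assume "X \<in> image facet ` D"
    then obtain x where x: "x \<in> P" "X = facet ` \<tau> x" using D_point by blast
    have "cell (\<tau> x) \<subseteq> facet i \<longleftrightarrow> i \<in> \<tau> x" if "i \<in> I" for i
      using x that by (auto simp: cell_def facet_def tight_def)
    then have "X = {F. F facet_of P \<and> cell (\<tau> x) \<subseteq> F}"
      using x(2) facets by (auto simp: tight_def)
    moreover have "cell (\<tau> x) \<noteq> {}" using x by (auto simp: cell_def)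
    ultimately show "X \<in> dual_boundary_complex P"
      using cell_face by (auto simp: dual_boundary_complex_def)
  qed
qed

end

text \<open>Barycentric coordinates serve as slacks: they exist everywhere because the simplex has
  full dimension, the simplex is where all are nonnegative, and a tight set is a set of vanishing
  coordinates. Coordinates sum to 1, so exactly the proper subsets of \<open>I\<close> occur. The
  index set is left free for later labelling.\<close>

lemma simplex_hpoly:
  fixes Q :: "'a::euclidean_space set" and I :: "'i set"
  assumes Q: "int n simplex Q" and n: "DIM('a) = n" and I: "finite I" "card I = Suc n"
  shows "\<exists>c d. hpoly I c d = Q \<and> simple_hpoly I c d (Pow I - {I})"
proof -
  obtain C where C: "finite C" "\<not> affine_dependent C" "card C = Suc n" "Q = convex hull C"
    using Q by (force simp: simplex)
  obtain g where g: "bij_betw g I C"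
    using I C finite_same_card_bij by metis
  \<comment> \<open>The pair \<open>p\<close> holds normal and bound of the hyperplane through all
    vertices but \<open>g i\<close>, divided by the slack at \<open>g i\<close> so that this slack
    becomes 1.\<close>
  have "\<exists>p. \<forall>j\<in>I. snd p - fst p \<bullet> g j = (if j = i then 1 else 0)" if i: "i \<in> I" for i
  proof -
    have gi: "g i \<in> C" using g i by (auto simp: bij_betw_def)
    have "\<not> affine_dependent (C - {g i})"
      using C(2) affine_dependent_subset[of "C - {g i}" C] by blast
    then have "int (card (C - {g i})) = aff_dim (C - {g i}) + 1"
      by (rule aff_dim_affine_independent)
    moreover have "card (C - {g i}) = n" using C gi by simp
    ultimately have "aff_dim (C - {g i}) = int (DIM('a) - 1)"
      using n DIM_positive[where 'a = 'a] by linarith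
    then have "\<exists>a b. a \<noteq> 0 \<and> affine hull (C - {g i}) = {x. a \<bullet> x = b}"
      by (simp only: aff_dim_eq_hyperplane)
    then obtain a b where ab: "affine hull (C - {g i}) = {x. a \<bullet> x = b}" by blast
    have "g i \<notin> affine hull (C - {g i})" using C(2) gi by (auto simp: affine_dependent_def)
    then have nz: "b - a \<bullet> g i \<noteq> 0" using ab by auto
    have scaled: "b / s - (a /\<^sub>R s) \<bullet> x = (b - a \<bullet> x) / s" for s x
      by (simp add: divide_inverse algebra_simps)
    show ?thesis
    proof (rule exI[of _ "(a /\<^sub>R (b - a \<bullet> g i), b / (b - a \<bullet> g i))"], unfold fst_conv snd_conv scaled, rule ballI)
      fix j assume j: "j \<in> I"
      show "(b - a \<bullet> g j) / (b - a \<bullet> g i) = (if j = i then 1 else 0)"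
      proof (cases "j = i")
        case False
        then have "g j \<in> C - {g i}" using g i j by (auto simp: bij_betw_def inj_on_def)
        then have "g j \<in> affine hull (C - {g i})" by (rule hull_inc)
        then show ?thesis unfolding ab using False by simp
      qed (use nz in simp)
    qed
  qed
  then obtain p where p: "\<And>i j. i \<in> I \<Longrightarrow> j \<in> I \<Longrightarrow> snd (p i) - fst (p i) \<bullet> g j = (if j = i then 1 else 0)"
    using bchoice[of I "\<lambda>i q. \<forall>j\<in>I. snd q - fst q \<bullet> g j = (if j = i then 1 else 0)"] by blast
  define c where "c = fst \<circ> p"
  define d where "d = snd \<circ> p"
  have cd: "d i - c i \<bullet> g j = (if j = i then 1 else 0)" if "i \<in> I" "j \<in> I" for i j
    using p[OF that] by (simp add: c_def d_def)
  have coord: "d i - c i \<bullet> (\<Sum>j\<in>I. u j *\<^sub>R g j) = u i" if "i \<in> I" "sum u I = 1" for u i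
  proof -
    have "d i - c i \<bullet> (\<Sum>j\<in>I. u j *\<^sub>R g j) = (\<Sum>j\<in>I. u j * d i) - (\<Sum>j\<in>I. u j * (c i \<bullet> g j))"
      using that by (simp add: inner_sum_right flip: sum_distrib_right)
    also have "\<dots> = (\<Sum>j\<in>I. u j * (d i - c i \<bullet> g j))"
      by (simp add: sum_subtractf right_diff_distrib)
    also have "\<dots> = (\<Sum>j\<in>I. if j = i then u j else 0)"
      by (intro sum.cong) (auto simp: cd that)
    also have "\<dots> = u i" using that I by simp
    finally show ?thesis .
  qed
  have reindex: "sum (\<lambda>v. w v *\<^sub>R v) C = (\<Sum>j\<in>I. w (g j) *\<^sub>R g j)" "sum w C = (\<Sum>j\<in>I. w (g j))" for w
    using sum.reindex_bij_betw[OF g, of "\<lambda>v. w v *\<^sub>R v"] sum.reindex_bij_betw[OF g, of w] by simp_all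
  have "aff_dim C = int DIM('a)" using C(3) n aff_dim_affine_independent[OF C(2)] by linarith
  then have UN: "affine hull C = UNIV" by (simp add: aff_dim_eq_full)
  have bary: "\<exists>u. sum u I = 1 \<and> x = (\<Sum>j\<in>I. u j *\<^sub>R g j)" for x
  proof -
    have "x \<in> affine hull C" using UN by simp
    then obtain w where "sum w C = 1" "sum (\<lambda>v. w v *\<^sub>R v) C = x"
      by (auto simp: affine_hull_finite[OF C(1)])
    then show ?thesis using reindex[of w] by (intro exI[of _ "w \<circ> g"]) (simp add: o_def)
  qed
  have comb_in: "(\<Sum>j\<in>I. u j *\<^sub>R g j) \<in> convex hull C" if "sum u I = 1" "\<And>j. j \<in> I \<Longrightarrow> u j \<ge> 0" for u
    using that g by (intro convex_sum) (auto simp: I bij_betw_def hull_inc)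
  have PQ: "hpoly I c d = Q"
  proof (intro set_eqI iffI)
    fix x assume x: "x \<in> hpoly I c d"
    obtain u where u: "sum u I = 1" "x = (\<Sum>j\<in>I. u j *\<^sub>R g j)" using bary by blast
    then have "u i \<ge> 0" if "i \<in> I" for i using x coord[OF that u(1)] that by (auto simp: hpoly_def)
    then show "x \<in> Q" using comb_in u C by simp
  next
    fix x assume "x \<in> Q"
    then obtain w where w: "\<forall>v\<in>C. 0 \<le> w v" "sum w C = 1" "sum (\<lambda>v. w v *\<^sub>R v) C = x"
      by (auto simp: C convex_hull_finite)
    then have u: "sum (w \<circ> g) I = 1" "x = (\<Sum>j\<in>I. (w \<circ> g) j *\<^sub>R g j)" using reindex[of w] by simp_all
    show "x \<in> hpoly I c d" unfolding hpoly_def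
    proof clarify
      fix i assume i: "i \<in> I"
      then have "w (g i) \<ge> 0" using w g by (auto simp: bij_betw_def)
      then show "c i \<bullet> x \<le> d i" using coord[OF i u(1)] u(2) by simp
    qed
  qed
  have tight_eq: "tight I c d (\<Sum>j\<in>I. u j *\<^sub>R g j) = {i\<in>I. u i = 0}" if "sum u I = 1" for u
    using coord[OF _ that] by (fastforce simp: tight_def)
  have Ine: "I \<noteq> {}" using I by auto
  have "simple_hpoly I c d (Pow I - {I})"
  proof
    show "bounded (hpoly I c d)"
      unfolding PQ using Q by (simp add: compact_simplex compact_imp_bounded)
    show "tight I c d ` hpoly I c d = Pow I - {I}"
    proof (intro set_eqI iffI)
      fix T assume "T \<in> tight I c d ` hpoly I c d"
      then obtain x where x: "T = tight I c d x" by blast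
      obtain u where u: "sum u I = 1" "x = (\<Sum>j\<in>I. u j *\<^sub>R g j)" using bary by blast
      have "T = {i\<in>I. u i = 0}" using tight_eq u x by simp
      moreover have "\<exists>i\<in>I. u i \<noteq> 0" using u(1) by (metis sum.neutral zero_neq_one)
      ultimately show "T \<in> Pow I - {I}" by blast
    next
      fix T assume T: "T \<in> Pow I - {I}"
      \<comment> \<open>Barycentre of the face spanned by the vertices with index in
        \<open>I - T\<close>; its coordinates vanish exactly on \<open>T\<close>.\<close>
      define u where "u = (\<lambda>i. if i \<in> T then 0 else 1 / real (card (I - T)))"
      have pos: "card (I - T) > 0" using T I by (metis DiffE Diff_eq_empty_iff Pow_iff card_gt_0_iff finite_Diff insert_iff subset_antisym)
      have "sum u I = (\<Sum>i\<in>I - T. 1 / real (card (I - T)))"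
        using I by (intro sum.mono_neutral_cong_right) (auto simp: u_def)
      then have s: "sum u I = 1" using pos by simp
      have "(\<Sum>j\<in>I. u j *\<^sub>R g j) \<in> hpoly I c d"
        unfolding PQ C(4) by (rule comb_in[OF s]) (simp add: u_def)
      moreover have "tight I c d (\<Sum>j\<in>I. u j *\<^sub>R g j) = T"
        using tight_eq[OF s] T pos by (auto simp: u_def)
      ultimately show "T \<in> tight I c d ` hpoly I c d" by blast
    qed
    \<comment> \<open>The dimension is positive, so \<open>I\<close> has at least two elements and
      singletons are proper subsets.\<close>
    have "I \<noteq> {i}" for i using I n DIM_positive[where 'a = 'a] by auto
    then show "{i} \<in> Pow I - {I}" if "i \<in> I" for i using that by blast
  qed (use I Ine in auto)
  then show ?thesis using PQ by blast
qed

section \<open>Simplicial isomorphisms\<close>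

lemma simplicial_iso_sym:
  assumes "simplicial_iso X Y"
  shows "simplicial_iso Y X"
proof -
  obtain f where f: "bij_betw f (\<Union>X) (\<Union>Y)" "\<And>S. S \<subseteq> \<Union>X \<Longrightarrow> S \<in> X \<longleftrightarrow> f ` S \<in> Y"
    using assms by (auto simp: simplicial_iso_def)
  let ?g = "inv_into (\<Union>X) f"
  show ?thesis unfolding simplicial_iso_def
  proof (intro exI[of _ ?g] conjI allI impI)
    show "bij_betw ?g (\<Union>Y) (\<Union>X)" using bij_betw_inv_into f(1) .
    fix S assume S: "S \<subseteq> \<Union>Y"
    have "f ` ?g ` S = S" using f(1) S by (metis bij_betw_def image_inv_into_cancel)
    moreover have "?g ` S \<subseteq> \<Union>X" using f(1) S by (metis bij_betw_def bij_betw_inv_into image_mono)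
    ultimately show "S \<in> Y \<longleftrightarrow> ?g ` S \<in> X" using f(2)[of "?g ` S"] by simp
  qed
qed

lemma simplicial_iso_trans:
  assumes "simplicial_iso X Y" "simplicial_iso Y Z"
  shows "simplicial_iso X Z"
proof -
  obtain f where f: "bij_betw f (\<Union>X) (\<Union>Y)" "\<And>S. S \<subseteq> \<Union>X \<Longrightarrow> S \<in> X \<longleftrightarrow> f ` S \<in> Y"
    using assms by (auto simp: simplicial_iso_def)
  obtain g where g: "bij_betw g (\<Union>Y) (\<Union>Z)" "\<And>S. S \<subseteq> \<Union>Y \<Longrightarrow> S \<in> Y \<longleftrightarrow> g ` S \<in> Z"
    using assms by (auto simp: simplicial_iso_def)
  show ?thesis unfolding simplicial_iso_def
  proof (intro exI[of _ "g \<circ> f"] conjI allI impI)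
    show "bij_betw (g \<circ> f) (\<Union>X) (\<Union>Z)" using bij_betw_trans f(1) g(1) .
    fix S assume S: "S \<subseteq> \<Union>X"
    then have "f ` S \<subseteq> \<Union>Y" using f(1) by (metis bij_betw_def image_mono)
    then show "S \<in> X \<longleftrightarrow> (g \<circ> f) ` S \<in> Z" using f(2)[OF S] g(2)[of "f ` S"] by (simp add: image_comp)
  qed
qed

lemma simplicial_iso_image:
  assumes "inj_on f (\<Union>X)"
  shows "simplicial_iso X (image f ` X)"
  unfolding simplicial_iso_def
proof (intro exI[of _ f] conjI allI impI)
  show "bij_betw f (\<Union>X) (\<Union>(image f ` X))" using assms by (auto simp: bij_betw_def)
  fix S assume S: "S \<subseteq> \<Union>X"
  have "S = T" if "f ` S = f ` T" "T \<in> X" for T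
    using inj_on_image_eq_iff[OF assms S, of T] that by blast
  then show "S \<in> X \<longleftrightarrow> f ` S \<in> image f ` X" by auto
qed

section \<open>The polar dual polytope and polytopality\<close>

lemma bounded_ray:
  fixes u :: "'a::real_normed_vector"
  assumes "bounded S" "\<And>t. t \<ge> 0 \<Longrightarrow> y + t *\<^sub>R u \<in> S"
  shows "u = 0"
proof (rule ccontr)
  assume u: "u \<noteq> 0"
  obtain B where B: "\<And>x. x \<in> S \<Longrightarrow> norm x \<le> B" using assms(1) by (auto simp: bounded_iff)
  define t where "t = (\<bar>B\<bar> + norm y + 1) / norm u"
  have t: "t \<ge> 0" "norm (t *\<^sub>R u) = \<bar>B\<bar> + norm y + 1" using u by (auto simp: t_def)
  have "norm (t *\<^sub>R u) \<le> norm (y + t *\<^sub>R u) + norm y"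
    by (metis add.commute add_diff_cancel_left' norm_triangle_ineq4)
  then show False using B[OF assms(2)[OF t(1)]] t(2) by linarith
qed

context simple_hpoly
begin

text \<open>If all constraints were tight at \<open>x\<close>, then \<open>P\<close> would be a cone
  with apex \<open>x\<close>, and the ray from an interior point \<open>y\<close> away from
  \<open>x\<close> would stay in \<open>P\<close>.\<close>

lemma index_set_not_in_D: "I \<notin> D"
proof
  assume "I \<in> D"
  then obtain x where x: "\<tau> x = I" using D_point by blast
  obtain y where y: "y \<in> P" "\<tau> y = {}" using D_point empty_in_D by blast
  have "y + t *\<^sub>R (y - x) \<in> P" if "t \<ge> 0" for t
    unfolding hpoly_def
  proof clarify
    fix i assume i: "i \<in> I"
    then have "c i \<bullet> x = d i" "c i \<bullet> y \<le> d i" using x y by (auto simp: tight_def hpoly_def)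
    then have "c i \<bullet> y + t * (c i \<bullet> y - d i) \<le> d i" using that by (simp add: add_decreasing2 mult_nonneg_nonpos)
    then show "c i \<bullet> (y + t *\<^sub>R (y - x)) \<le> d i"
      using \<open>c i \<bullet> x = d i\<close> by (simp add: inner_add_right inner_diff_right)
  qed
  \<comment> \<open>The remaining case \<open>y = x\<close> means that there are no constraints at
    all.\<close>
  then have "y - x = 0" using bounded_ray bdd by blast
  then have "I = {}" using x y by simp
  then have "P = UNIV" by (simp add: hpoly_def)
  then show False using bdd by simp
qed

text \<open>After translating an interior point to the origin, all constraints read \<open>e i \<bullet> z \<le> 1\<close>, and
  the polar dual is the convex hull of the \<open>e i\<close>.\<close>
lemma polytopal_D: "polytopal TYPE('a) D"
proof -
  obtain y where y: "y \<in> P" "\<tau> y = {}" using D_point empty_in_D by blast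
  define w where "w i = d i - c i \<bullet> y" for i
  define e where "e i = c i /\<^sub>R w i" for i
  define R where "R = convex hull (e ` I)"
  have w: "w i > 0" if "i \<in> I" for i using y that by (force simp: w_def tight_def hpoly_def)
  have e_le: "e i \<bullet> z \<le> 1 \<longleftrightarrow> c i \<bullet> (y + z) \<le> d i" and e_eq: "e i \<bullet> z = 1 \<longleftrightarrow> c i \<bullet> (y + z) = d i"
    if "i \<in> I" for i z
    using w[OF that] by (auto simp: e_def inner_add_right w_def field_simps)
  have in_P: "y + z \<in> P \<longleftrightarrow> (\<forall>i\<in>I. e i \<bullet> z \<le> 1)" for z using e_le by (auto simp: hpoly_def)
  have tight_e: "\<tau> (y + z) = {i\<in>I. e i \<bullet> z = 1}" for z using e_eq by (auto simp: tight_def)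
  have D_z: "\<exists>z. (\<forall>i\<in>I. e i \<bullet> z \<le> 1) \<and> {i\<in>I. e i \<bullet> z = 1} = T" if T: "T \<in> D" for T
  proof -
    obtain x where "x \<in> P" "\<tau> x = T" using D_point T by blast
    then show ?thesis using in_P[of "x - y"] tight_e[of "x - y"] by (intro exI[of _ "x - y"]) auto
  qed
  have inj: "inj_on e I"
  proof (rule inj_onI)
    fix i j assume ij: "i \<in> I" "j \<in> I" "e i = e j"
    obtain z where z: "{k\<in>I. e k \<bullet> z = 1} = {i}" using D_z[OF sing[OF ij(1)]] by blast
    then have "e i \<bullet> z = 1" by blast
    then have "j \<in> {k\<in>I. e k \<bullet> z = 1}" using ij by simp
    then show "i = j" unfolding z by simp
  qed
  \<comment> \<open>Since \<open>T - {i}\<close> is again in \<open>D\<close>, some \<open>z\<close>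
    has exactly these constraints tight; the hyperplane it defines contains every \<open>e k\<close>
    with \<open>k\<close> in \<open>T - {i}\<close> but not \<open>e i\<close>.\<close>
  have indep: "\<not> affine_dependent (e ` T)" if T: "T \<in> D" for T
    unfolding affine_dependent_def
  proof clarify
    fix i assume i: "i \<in> T" "e i \<in> affine hull (e ` T - {e i})"
    obtain z where z: "{k\<in>I. e k \<bullet> z = 1} = T - {i}" using D_z[OF down[OF T, of "T - {i}"]] by blast
    have "e ` T - {e i} \<subseteq> {u. z \<bullet> u = 1}"
    proof clarify
      fix k assume "k \<in> T" "e k \<noteq> e i"
      then have "k \<in> {k\<in>I. e k \<bullet> z = 1}" unfolding z by auto
      then show "z \<bullet> e k = 1" by (simp add: inner_commute)
    qed
    then have "affine hull (e ` T - {e i}) \<subseteq> {u. z \<bullet> u = 1}"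
      by (intro hull_minimal affine_hyperplane)
    then have "e i \<bullet> z = 1" using i(2) by (auto simp: inner_commute)
    then have "i \<in> {k\<in>I. e k \<bullet> z = 1}" using D_sub[OF T] i(1) by auto
    then show False unfolding z by simp
  qed
  \<comment> \<open>Each \<open>z\<close> with \<open>y + z\<close> in \<open>P\<close> gives a
    supporting hyperplane of \<open>R\<close>, and the face it cuts out is spanned by the generators
    on it, that is, by the tight constraints.\<close>
  have R_face: "R \<inter> {u. z \<bullet> u = 1} face_of R" 
    and R_hull: "R \<inter> {u. z \<bullet> u = 1} = convex hull (e ` {i\<in>I. e i \<bullet> z = 1})"
    if z: "\<forall>i\<in>I. e i \<bullet> z \<le> 1" for z
  proof -
    have le: "R \<subseteq> {u. z \<bullet> u \<le> 1}" unfolding R_def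
      using z by (intro hull_minimal convex_halfspace_le) (auto simp: inner_commute)
    then show face: "R \<inter> {u. z \<bullet> u = 1} face_of R"
      by (intro face_of_Int_supporting_hyperplane_le) (auto simp: R_def)
    then obtain S where S: "S \<subseteq> e ` I" "R \<inter> {u. z \<bullet> u = 1} = convex hull S"
      unfolding R_def using face_of_convex_hull_subset fin by (metis finite_imageI finite_imp_compact)
    then have "S \<subseteq> R \<inter> {u. z \<bullet> u = 1}" by (simp add: hull_subset)
    then have "S \<subseteq> e ` {i\<in>I. e i \<bullet> z = 1}"
      using S(1) by (auto simp: image_iff subset_iff inner_commute[of z])
    moreover have "e ` {i\<in>I. e i \<bullet> z = 1} \<subseteq> R \<inter> {u. z \<bullet> u = 1}"
      by (auto simp: R_def hull_inc inner_commute)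
    then have "convex hull (e ` {i\<in>I. e i \<bullet> z = 1}) \<subseteq> R \<inter> {u. z \<bullet> u = 1}"
      by (intro hull_minimal face_of_imp_convex[OF face]) (auto simp: R_def)
    ultimately show "R \<inter> {u. z \<bullet> u = 1} = convex hull (e ` {i\<in>I. e i \<bullet> z = 1})"
      using S(2) hull_mono by blast
  qed
  have R_polytope: "polytope R" unfolding R_def polytope_def using fin by blast
  have face_iff: "G face_of R \<and> G \<noteq> R \<longleftrightarrow> (\<exists>T\<in>D. G = convex hull (e ` T))" for G
  proof
    assume G: "G face_of R \<and> G \<noteq> R"
    show "\<exists>T\<in>D. G = convex hull (e ` T)"
    proof (cases "G = {}")
      case True then show ?thesis using empty_in_D by (intro bexI[of _ "{}"]) auto
    next
      case False
      have "G exposed_face_of R"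
        using G exposed_face_of_polyhedron R_polytope polytope_imp_polyhedron by blast
      then obtain a b where ab: "a \<noteq> 0" "R \<subseteq> {u. a \<bullet> u \<le> b}" "G = R \<inter> {u. a \<bullet> u = b}"
        using G False by (auto simp: exposed_face_of)
      have eR: "e i \<bullet> a \<le> b" if "i \<in> I" for i
        using ab(2) that by (metis (no_types, lifting) R_def hull_inc imageI inner_commute mem_Collect_eq subsetD)
      \<comment> \<open>Otherwise \<open>y + t a\<close> would satisfy all constraints for every
        \<open>t \<ge> 0\<close>, against boundedness. Dividing by \<open>b\<close> then brings the
        exposing hyperplane into the form \<open>z \<bullet> u = 1\<close>.\<close>
      have "b > 0"
      proof (rule ccontr)
        assume "\<not> b > 0"
        have "y + t *\<^sub>R a \<in> P" if "t \<ge> 0" for t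
          unfolding in_P
        proof
          fix i assume i: "i \<in> I"
          have "e i \<bullet> a \<le> 0" using eR[OF i] \<open>\<not> b > 0\<close> by simp
          then have "t * (e i \<bullet> a) \<le> 0" using that by (simp add: mult_nonneg_nonpos)
          then show "e i \<bullet> (t *\<^sub>R a) \<le> 1" by simp
        qed
        then show False using bounded_ray[OF bdd] ab(1) by blast
      qed
      define z where "z = a /\<^sub>R b"
      have z: "\<forall>i\<in>I. e i \<bullet> z \<le> 1" using eR \<open>b > 0\<close> by (auto simp: z_def field_simps)
      have "{u. a \<bullet> u = b} = {u. z \<bullet> u = 1}" using \<open>b > 0\<close> by (auto simp: z_def field_simps)
      then have "G = convex hull (e ` {i\<in>I. e i \<bullet> z = 1})" using ab(3) R_hull[OF z] by simp
      then show ?thesis using tight_in_D[of "y + z"] in_P z tight_e by metis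
    qed
  next
    assume "\<exists>T\<in>D. G = convex hull (e ` T)"
    then obtain T where T: "T \<in> D" "G = convex hull (e ` T)" by blast
    obtain z where z: "\<forall>i\<in>I. e i \<bullet> z \<le> 1" "{i\<in>I. e i \<bullet> z = 1} = T" using D_z[OF T(1)] by blast
    have G: "G = R \<inter> {u. z \<bullet> u = 1}" using R_hull[OF z(1)] z(2) T(2) by simp
    \<comment> \<open>\<open>G = R\<close> would make all constraints tight at one point.\<close>
    have "G \<noteq> R"
    proof
      assume "G = R"
      have "e i \<bullet> z = 1" if "i \<in> I" for i
      proof -
        have "e i \<in> R" using that by (simp add: R_def hull_inc)
        then have "e i \<in> {u. z \<bullet> u = 1}" using G \<open>G = R\<close> by blast
        then show ?thesis by (simp add: inner_commute)
      qed
      then have "T = I" using z(2) by blast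
      then show False using index_set_not_in_D T(1) by simp
    qed
    then show "G face_of R \<and> G \<noteq> R" using R_face[OF z(1)] G by simp
  qed
  have "simplicial_polytope R"
    unfolding simplicial_polytope_def
  proof (intro conjI allI impI)
    fix G assume "G face_of R \<and> G \<noteq> R"
    then obtain T where T: "T \<in> D" "G = convex hull (e ` T)" using face_iff by blast
    then have "(int (card (e ` T)) - 1) simplex G" using simplex_convex_hull indep by force
    then show "\<exists>n. n simplex G" ..
  qed (fact R_polytope)
  moreover have "boundary_complex R = image e ` D"
  proof -
    have extr: "{v. v extreme_point_of (convex hull (e ` T))} = e ` T" if "T \<in> D" for T
      using extreme_point_of_convex_hull_affine_independent[OF indep[OF that]] by simp
    have "boundary_complex R = (\<lambda>T. {v. v extreme_point_of (convex hull (e ` T))}) ` D"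
      unfolding boundary_complex_def face_iff by blast
    also have "\<dots> = image e ` D" using extr by (rule image_cong[OF refl])
    finally show ?thesis .
  qed
  moreover have "simplicial_iso D (image e ` D)"
    using inj by (intro simplicial_iso_image) (simp add: Union_D)
  ultimately show ?thesis unfolding polytopal_def by metis
qed

lemma simplicial_iso_dual_boundary: "simplicial_iso D (dual_boundary_complex P)"
  unfolding dual_boundary using facet_inj by (intro simplicial_iso_image) (simp add: Union_D)

end

lemma polytopal_simplicial_iso:
  "polytopal TYPE('a::euclidean_space) Y \<Longrightarrow> simplicial_iso X Y \<Longrightarrow> polytopal TYPE('a) X"
  unfolding polytopal_def using simplicial_iso_trans by blast

section \<open>Chordality\<close>

lemma adj_sym: "adj X u v \<longleftrightarrow> adj X v u"
  by (auto simp: adj_def insert_commute)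

lemma adj_simplicial_iso:
  assumes f: "bij_betw f (\<Union>X) (\<Union>Y)" "\<And>S. S \<subseteq> \<Union>X \<Longrightarrow> S \<in> X \<longleftrightarrow> f ` S \<in> Y"
    and uv: "u \<in> \<Union>X" "v \<in> \<Union>X"
  shows "adj Y (f u) (f v) \<longleftrightarrow> adj X u v"
proof -
  have "f u = f v \<longleftrightarrow> u = v" using f(1) uv by (meson bij_betw_def inj_on_eq_iff)
  moreover have "{f u, f v} \<in> Y \<longleftrightarrow> {u, v} \<in> X" using f(2)[of "{u, v}"] uv by simp
  ultimately show ?thesis by (simp add: adj_def)
qed

lemma chordal_simplicial_iso:
  assumes iso: "simplicial_iso X Y" and Y: "chordal_complex Y"
  shows "chordal_complex X"
  unfolding chordal_complex_def
proof (intro notI, elim exE conjE)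
  fix cs assume cs: "length cs \<ge> 4" "distinct cs"
    "\<forall>i<length cs. adj X (cs ! i) (cs ! ((i + 1) mod length cs))"
    "\<forall>i<length cs. \<forall>j<length cs. adj X (cs ! i) (cs ! j) \<longrightarrow>
       j = (i + 1) mod length cs \<or> i = (j + 1) mod length cs"
  obtain f where f: "bij_betw f (\<Union>X) (\<Union>Y)" "\<And>S. S \<subseteq> \<Union>X \<Longrightarrow> S \<in> X \<longleftrightarrow> f ` S \<in> Y"
    using iso by (auto simp: simplicial_iso_def)
  have vert: "cs ! i \<in> \<Union>X" if "i < length cs" for i
    using cs(3) that by (auto simp: adj_def)
  then have "set cs \<subseteq> \<Union>X" by (metis in_set_conv_nth subsetI)
  then have "distinct (map f cs)"
    using cs(2) f(1) by (auto simp: distinct_map bij_betw_def intro: inj_on_subset)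
  moreover have adj: "adj Y (map f cs ! i) (map f cs ! j) \<longleftrightarrow> adj X (cs ! i) (cs ! j)"
    if "i < length cs" "j < length cs" for i j
    using adj_simplicial_iso[OF f vert[OF that(1)] vert[OF that(2)]] that by simp
  moreover have "(i + 1) mod length cs < length cs" for i using cs(1) by (intro mod_less_divisor) linarith
  ultimately show False
    using Y cs unfolding chordal_complex_def
    by (metis (no_types, lifting) length_map)
qed

text \<open>Serves the segment and the triangle, whose dual boundary complexes have at most three
  vertices.\<close>

lemma chordal_few_vertices:
  assumes "finite (\<Union>X)" "card (\<Union>X) \<le> 3"
  shows "chordal_complex X"
  unfolding chordal_complex_def
proof (intro notI, elim exE conjE)
  fix cs assume cs: "length cs \<ge> 4" "distinct cs"
    "\<forall>i<length cs. adj X (cs ! i) (cs ! ((i + 1) mod length cs))"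
  have "set cs \<subseteq> \<Union>X"
  proof
    fix v assume "v \<in> set cs"
    then obtain i where "i < length cs" "v = cs ! i" by (metis in_set_conv_nth)
    then show "v \<in> \<Union>X" using cs(3) by (auto simp: adj_def)
  qed
  then have "card (set cs) \<le> 3" using assms card_mono by (meson order_trans)
  then show False using cs distinct_card by fastforce
qed

text \<open>The vertices at positions 0 and 2 of a cycle of length at least 4 would be a chord.
  Serves simplices of dimension at least 3.\<close>

lemma chordal_complete_graph:
  assumes "\<And>u v. u \<in> \<Union>X \<Longrightarrow> v \<in> \<Union>X \<Longrightarrow> u \<noteq> v \<Longrightarrow> {u, v} \<in> X"
  shows "chordal_complex X"
  unfolding chordal_complex_def
proof (intro notI, elim exE conjE)
  fix cs assume cs: "length cs \<ge> 4" "distinct cs"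
    "\<forall>i<length cs. adj X (cs ! i) (cs ! ((i + 1) mod length cs))"
    "\<forall>i<length cs. \<forall>j<length cs. adj X (cs ! i) (cs ! j) \<longrightarrow>
       j = (i + 1) mod length cs \<or> i = (j + 1) mod length cs"
  have len: "0 < length cs" "2 < length cs" using cs(1) by linarith+
  have "cs ! 0 \<in> \<Union>X" "cs ! 2 \<in> \<Union>X" using cs(3) len by (auto simp: adj_def)
  moreover have "cs ! 0 \<noteq> cs ! 2" using cs(2) len by (simp add: nth_eq_iff_index_eq)
  ultimately have "adj X (cs ! 0) (cs ! 2)" using assms by (simp add: adj_def)
  then have "2 = (0 + 1) mod length cs \<or> 0 = (2 + 1) mod length cs" using cs(4) len by blast
  then show False using cs(1) by simp
qed

text \<open>Stacking adds a vertex whose neighbours form a clique; an induced cycle of length at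
  least 4 cannot pass through such a vertex.\<close>
lemma chordal_stacked:
  assumes D: "chordal_complex D" and down: "\<And>T S. T \<in> D \<Longrightarrow> S \<subseteq> T \<Longrightarrow> S \<in> D"
    and T: "T \<in> D" "card T \<ge> 3" and z: "z \<notin> \<Union>D"
  shows "chordal_complex (stacked z T D)"
  unfolding chordal_complex_def
proof (intro notI, elim exE conjE)
  let ?S = "stacked z T D"
  fix cs assume cs: "length cs \<ge> 4" "distinct cs"
    "\<forall>i<length cs. adj ?S (cs ! i) (cs ! ((i + 1) mod length cs))"
    "\<forall>i<length cs. \<forall>j<length cs. adj ?S (cs ! i) (cs ! j) \<longrightarrow>
       j = (i + 1) mod length cs \<or> i = (j + 1) mod length cs"
  \<comment> \<open>With at least three vertices \<open>T\<close> is not an edge, so its removal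
    leaves the graph on the old vertices unchanged.\<close>
  have T_ne: "T \<noteq> {u, v}" for u v using T(2) card_insert_le_m1[of 2 "{v}" u] by auto
  have old: "adj ?S u v \<longleftrightarrow> adj D u v" if "u \<noteq> z" "v \<noteq> z" for u v
  proof -
    have "{u, v} \<noteq> insert z S" for S using that by (metis insertE insertI1 singletonD)
    moreover have "{u, v} \<noteq> T" using T_ne by metis
    ultimately have "{u, v} \<in> ?S \<longleftrightarrow> {u, v} \<in> D" by (simp add: stacked_def)
    then show ?thesis by (simp add: adj_def)
  qed
  have nbr: "v \<in> T" if "adj ?S z v" for v
  proof -
    have "{z, v} \<notin> D" "z \<noteq> v" using that z by (auto simp: adj_def)
    then have "{z, v} \<in> {insert z S | S. S \<subset> T}"
      using that unfolding adj_def stacked_def by blast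
    then obtain S where "{z, v} = insert z S" "S \<subset> T" by blast
    then have "v \<in> insert z S" by (metis insertI1 insert_commute)
    then show ?thesis using \<open>z \<noteq> v\<close> \<open>S \<subset> T\<close> by blast
  qed
  let ?n = "length cs"
  show False
  proof (cases "z \<in> set cs")
    case False
    then have "cs ! i \<noteq> z" if "i < ?n" for i using that by auto
    moreover have "(i + 1) mod ?n < ?n" for i using cs(1) by (intro mod_less_divisor) linarith
    ultimately have "adj ?S (cs ! i) (cs ! j) \<longleftrightarrow> adj D (cs ! i) (cs ! j)"
      "adj ?S (cs ! i) (cs ! ((i + 1) mod ?n)) \<longleftrightarrow> adj D (cs ! i) (cs ! ((i + 1) mod ?n))"
      if "i < ?n" "j < ?n" for i j using old that by blast+
    then show False using D cs unfolding chordal_complex_def by blast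
  next
    case True
    then obtain p where p: "p < ?n" "cs ! p = z" by (metis in_set_conv_nth)
    \<comment> \<open>\<open>q\<close> and \<open>r\<close> are the cyclic successor and predecessor
      of the position \<open>p\<close> of \<open>z\<close>, written without \<open>mod\<close> to
      allow case splits.\<close>
    define q where "q = (if p + 1 = ?n then 0 else p + 1)"
    define r where "r = (if p = 0 then ?n - 1 else p - 1)"
    have q: "q < ?n" "q = (p + 1) mod ?n" using p cs(1) by (auto simp: q_def)
    have r: "r < ?n" "p = (r + 1) mod ?n" using p cs(1) by (auto simp: r_def)
    have "q \<noteq> p" "r \<noteq> p" "q \<noteq> r" using p cs(1) by (auto simp: q_def r_def split: if_splits)
    then have neq: "cs ! q \<noteq> z" "cs ! r \<noteq> z" "cs ! q \<noteq> cs ! r"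
      using p q(1) r(1) cs(2) by (auto simp: nth_eq_iff_index_eq)
    have "cs ! q \<in> T" using cs(3) p q nbr by metis
    moreover have "cs ! r \<in> T" using cs(3) p r nbr adj_sym by metis
    ultimately have "adj D (cs ! q) (cs ! r)" using neq(3) down[OF T(1)] by (simp add: adj_def)
    then have "adj ?S (cs ! q) (cs ! r)" using old neq by blast
    then have "r = (q + 1) mod ?n \<or> q = (r + 1) mod ?n" using cs(4) q(1) r(1) by blast
    \<comment> \<open>The two neighbours of \<open>z\<close> are joined, so they must be consecutive
      in the cycle. Going round the other way than through \<open>z\<close> closes the cycle after
      three steps.\<close>
    then have "r = (q + 1) mod ?n" using r(2) \<open>q \<noteq> p\<close> by simp
    then show False using p(1) cs(1)
      by (auto simp: q_def r_def mod_Suc split: if_splits)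
  qed
qed

text \<open>The new facets \<open>insert z (T - {j})\<close> have the size of \<open>T\<close>, and
  they take over the faces that were contained in no facet but \<open>T\<close>.\<close>

lemma pure_stacked:
  assumes pure: "\<forall>S\<in>D. \<exists>U\<in>D. S \<subseteq> U \<and> card U = n"
    and T: "T \<in> D" "finite T" "card T = n" "n > 0" and z: "z \<notin> T"
  shows "\<forall>S\<in>stacked z T D. \<exists>U\<in>stacked z T D. S \<subseteq> U \<and> card U = n"
proof
  have new: "\<exists>U\<in>stacked z T D. insert z S \<subseteq> U \<and> card U = n" if S: "S \<subset> T" for S
  proof -
    obtain j where j: "j \<in> T" "j \<notin> S" using S by blast
    have "insert z (T - {j}) \<in> stacked z T D" using j by (auto simp: stacked_def)
    moreover have "card (insert z (T - {j})) = n"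
      using j T z by (simp add: card_Diff_singleton)
    ultimately show ?thesis using S j by (intro bexI[of _ "insert z (T - {j})"]) auto
  qed
  fix S assume "S \<in> stacked z T D"
  then consider "S \<in> D" "S \<noteq> T" | R where "S = insert z R" "R \<subset> T" by (auto simp: stacked_def)
  then show "\<exists>U\<in>stacked z T D. S \<subseteq> U \<and> card U = n"
  proof cases
    case 1
    obtain U where U: "U \<in> D" "S \<subseteq> U" "card U = n" using pure 1 by blast
    show ?thesis
    proof (cases "U = T")
      case True
      then show ?thesis using new[of S] U 1 by blast
    next
      case False
      then show ?thesis using U by (auto simp: stacked_def)
    qed
  next
    case 2
    then show ?thesis using new by blast
  qed
qed

text \<open>Purity is part of the induction because it fixes the size of the removed face: the tight
  set of a vertex is maximal, so it has exactly \<open>n\<close> elements. With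
  \<open>n \<ge> 3\<close> this meets the size conditions of both \<open>truncation\<close> and
  \<open>chordal_stacked\<close>. Labels in \<open>nat\<close> leave a fresh one for each
  cut.\<close>

lemma vertex_truncation_chordal:
  fixes Q :: "'a::euclidean_space set"
  assumes "vertex_truncation n k Q" "DIM('a) = n" "n \<ge> 3"
  shows "\<exists>(I :: nat set) c d D. hpoly I c d = Q \<and> simple_hpoly I c d D \<and> chordal_complex D \<and>
           (\<forall>S\<in>D. \<exists>U\<in>D. S \<subseteq> U \<and> card U = n)"
  using assms
proof (induction rule: vertex_truncation.induct)
  case (base n Q)
  define I where "I = {0..n}"
  have I: "finite I" "card I = Suc n" by (simp_all add: I_def)
  obtain c :: "nat \<Rightarrow> 'a" and d where cd: "hpoly I c d = Q" "simple_hpoly I c d (Pow I - {I})"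
    using simplex_hpoly[OF base(1) base(2) I] by blast
  have "chordal_complex (Pow I - {I})"
  proof (rule chordal_complete_graph)
    fix u v assume "u \<in> \<Union>(Pow I - {I})" "v \<in> \<Union>(Pow I - {I})"
    \<comment> \<open>\<open>I\<close> has \<open>n + 1 \<ge> 4\<close> elements.\<close>
    moreover have "{u, v} \<noteq> I" using card_insert_le_m1[of 2 "{v}" u] I base(3) by auto
    ultimately show "{u, v} \<in> Pow I - {I}" by blast
  qed
  moreover have "\<forall>S\<in>Pow I - {I}. \<exists>U\<in>Pow I - {I}. S \<subseteq> U \<and> card U = n"
  proof
    fix S assume "S \<in> Pow I - {I}"
    then obtain j where j: "j \<in> I" "S \<subseteq> I - {j}" by blast
    then show "\<exists>U\<in>Pow I - {I}. S \<subseteq> U \<and> card U = n"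
      using I by (intro bexI[of _ "I - {j}"]) auto
  qed
  ultimately show ?case using cd by blast
next
  case (step n k Q v a b)
  obtain I :: "nat set" and c d D where rep: "hpoly I c d = Q" "simple_hpoly I c d D"
    and D: "chordal_complex D" "\<forall>S\<in>D. \<exists>U\<in>D. S \<subseteq> U \<and> card U = n"
    using step by blast
  interpret simple_hpoly I c d D by (fact rep(2))
  obtain z where z: "z \<notin> I" using fin ex_new_if_finite infinite_UNIV_nat by blast
  let ?T = "tight I c d v"
  have v: "v extreme_point_of hpoly I c d" using step rep by simp
  then have vP: "v \<in> hpoly I c d" by (simp add: extreme_point_of_def)
  have TD: "?T \<in> D" using tight_in_D[OF vP] .
  then obtain U where U: "U \<in> D" "?T \<subseteq> U" "card U = n" using D(2) by blast
  then obtain x where "x \<in> hpoly I c d" "tight I c d x = U" using D_point by blast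
  then have "U = ?T" using vertex_tight_unique[OF v] U(2) by blast
  then have card: "card ?T = n" using U by simp
  have finT: "finite ?T" using fin by (simp add: tight_def)
  have w: "\<And>w. w extreme_point_of hpoly I c d \<Longrightarrow> w \<noteq> v \<Longrightarrow> a \<bullet> w < b" 
    using step.hyps(4) unfolding rep(1) by simp
  have card2: "2 \<le> card ?T" using card step.prems by simp
  note tr = truncation[OF v \<open>a \<bullet> v > b\<close> w z card2]
  have "chordal_complex (stacked z ?T D)"
    using chordal_stacked[OF D(1) down TD] card step.prems z Union_D by auto
  moreover have "\<forall>S\<in>stacked z ?T D. \<exists>U\<in>stacked z ?T D. S \<subseteq> U \<and> card U = n"
    using pure_stacked[OF D(2) TD finT card] step.prems z D_sub[OF TD] by auto
  ultimately show ?case using tr rep(1) by blast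
qed

section \<open>Explicit induced cycles\<close>

lemma induced_four_cycle_not_chordal:
  assumes adj: "adj X a b" "adj X b c" "adj X c d" "adj X d a"
    and nonadj: "\<not> adj X a c" "\<not> adj X b d"
    and neq: "a \<noteq> c" "b \<noteq> d"
  shows "\<not> chordal_complex X"
  unfolding chordal_complex_def not_not
proof (intro exI[of _ "[a, b, c, d]"] conjI allI impI)
  show "distinct [a, b, c, d]" using adj neq by (auto simp: adj_def)
  have idx: "i = 0 \<or> i = 1 \<or> i = 2 \<or> i = 3" if "i < length [a, b, c, d]" for i
    using that by simp linarith
  show "adj X ([a, b, c, d] ! i) ([a, b, c, d] ! ((i + 1) mod length [a, b, c, d]))"
    if "i < length [a, b, c, d]" for i
    using idx[OF that] adj by (elim disjE) simp_all
  have "\<not> adj X x x" for x by (simp add: adj_def)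
  moreover have "\<not> adj X c a" "\<not> adj X d b"
    using nonadj adj_sym by metis+
  ultimately show "j = (i + 1) mod length [a, b, c, d] \<or> i = (j + 1) mod length [a, b, c, d]"
    if "i < length [a, b, c, d]" "j < length [a, b, c, d]" "adj X ([a, b, c, d] ! i) ([a, b, c, d] ! j)" for i j
    using idx[OF that(1)] idx[OF that(2)] that(3) nonadj
    by (elim disjE) simp_all
qed simp

lemma induced_five_cycle_not_chordal:
  assumes adj: "adj X a b" "adj X b c" "adj X c d" "adj X d e" "adj X e a"
    and nonadj: "\<not> adj X a c" "\<not> adj X a d" "\<not> adj X b d" "\<not> adj X b e" "\<not> adj X c e"
    and neq: "a \<noteq> c" "a \<noteq> d" "b \<noteq> d" "b \<noteq> e" "c \<noteq> e"
  shows "\<not> chordal_complex X"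
  unfolding chordal_complex_def not_not
proof (intro exI[of _ "[a, b, c, d, e]"] conjI allI impI)
  show "distinct [a, b, c, d, e]" using adj neq by (auto simp: adj_def)
  have idx: "i = 0 \<or> i = 1 \<or> i = 2 \<or> i = 3 \<or> i = 4" if "i < length [a, b, c, d, e]" for i
    using that by simp linarith
  show "adj X ([a, b, c, d, e] ! i) ([a, b, c, d, e] ! ((i + 1) mod length [a, b, c, d, e]))"
    if "i < length [a, b, c, d, e]" for i
    using idx[OF that] adj by (elim disjE) simp_all
  have "\<not> adj X x x" for x by (simp add: adj_def)
  moreover have "\<not> adj X c a" "\<not> adj X d a" "\<not> adj X d b" "\<not> adj X e b" "\<not> adj X e c"
    using nonadj adj_sym by metis+
  ultimately show "j = (i + 1) mod length [a, b, c, d, e] \<or> i = (j + 1) mod length [a, b, c, d, e]"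
    if "i < length [a, b, c, d, e]" "j < length [a, b, c, d, e]" "adj X ([a, b, c, d, e] ! i) ([a, b, c, d, e] ! j)" for i j
    using idx[OF that(1)] idx[OF that(2)] that(3) nonadj
    by (elim disjE) simp_all
qed simp

lemma induced_six_cycle_not_chordal:
  assumes adj: "adj X a b" "adj X b c" "adj X c d" "adj X d e" "adj X e f" "adj X f a"
    and nonadj: "\<not> adj X a c" "\<not> adj X a d" "\<not> adj X a e" "\<not> adj X b d" "\<not> adj X b e" "\<not> adj X b f" "\<not> adj X c e" "\<not> adj X c f" "\<not> adj X d f"
    and neq: "a \<noteq> c" "a \<noteq> d" "a \<noteq> e" "b \<noteq> d" "b \<noteq> e" "b \<noteq> f" "c \<noteq> e" "c \<noteq> f" "d \<noteq> f"
  shows "\<not> chordal_complex X"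
  unfolding chordal_complex_def not_not
proof (intro exI[of _ "[a, b, c, d, e, f]"] conjI allI impI)
  show "distinct [a, b, c, d, e, f]" using adj neq by (auto simp: adj_def)
  have idx: "i = 0 \<or> i = 1 \<or> i = 2 \<or> i = 3 \<or> i = 4 \<or> i = 5" if "i < length [a, b, c, d, e, f]" for i
    using that by simp linarith
  show "adj X ([a, b, c, d, e, f] ! i) ([a, b, c, d, e, f] ! ((i + 1) mod length [a, b, c, d, e, f]))"
    if "i < length [a, b, c, d, e, f]" for i
    using idx[OF that] adj by (elim disjE) simp_all
  have "\<not> adj X x x" for x by (simp add: adj_def)
  moreover have "\<not> adj X c a" "\<not> adj X d a" "\<not> adj X e a" "\<not> adj X d b" "\<not> adj X e b" "\<not> adj X f b" "\<not> adj X e c" "\<not> adj X f c" "\<not> adj X f d"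
    using nonadj adj_sym by metis+
  ultimately show "j = (i + 1) mod length [a, b, c, d, e, f] \<or> i = (j + 1) mod length [a, b, c, d, e, f]"
    if "i < length [a, b, c, d, e, f]" "j < length [a, b, c, d, e, f]" "adj X ([a, b, c, d, e, f] ! i) ([a, b, c, d, e, f] ! j)" for i j
    using idx[OF that(1)] idx[OF that(2)] that(3) nonadj
    by (elim disjE) simp_all
qed simp

section \<open>Bier spheres\<close>

lemma bier_iff:
  "F \<in> bier m K \<longleftrightarrow> Inl -` F \<in> K \<and> Inr -` F \<in> alexander_dual m K \<and> Inl -` F \<inter> Inr -` F = {}"
proof
  assume "F \<in> bier m K"
  then obtain I J where "F = Inl ` I \<union> Inr ` J" "I \<in> K" "J \<in> alexander_dual m K" "I \<inter> J = {}"
    by (auto simp: bier_def)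
  moreover have "Inl -` (Inl ` I \<union> Inr ` J) = I" "Inr -` (Inl ` I \<union> Inr ` J) = J" by auto
  ultimately show "Inl -` F \<in> K \<and> Inr -` F \<in> alexander_dual m K \<and> Inl -` F \<inter> Inr -` F = {}" by simp
next
  assume "Inl -` F \<in> K \<and> Inr -` F \<in> alexander_dual m K \<and> Inl -` F \<inter> Inr -` F = {}"
  moreover have "F = Inl ` (Inl -` F) \<union> Inr ` (Inr -` F)"
  proof (rule set_eqI)
    show "x \<in> F \<longleftrightarrow> x \<in> Inl ` (Inl -` F) \<union> Inr ` (Inr -` F)" for x by (cases x) auto
  qed
  ultimately show "F \<in> bier m K" unfolding bier_def by blast
qed

locale nonfull_complex =
  fixes m :: nat and K :: "nat set set"
  assumes complex: "simplicial_complex_on m K" and nonfull: "K \<noteq> Pow {1..m}"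
begin

abbreviation "V \<equiv> {1..m}"
abbreviation "K' \<equiv> alexander_dual m K"

lemma down: "F \<in> K \<Longrightarrow> G \<subseteq> F \<Longrightarrow> G \<in> K"
  and sub: "F \<in> K \<Longrightarrow> F \<subseteq> V" and ne: "K \<noteq> {}"
  using complex by (auto simp: simplicial_complex_on_def)

lemma empty_in: "{} \<in> K"
  using down ne by blast

lemma V_notin: "V \<notin> K"
proof
  assume "V \<in> K"
  then have "K = Pow V" using down sub by blast
  then show False using nonfull by simp
qed

lemma dual_iff: "J \<in> K' \<longleftrightarrow> J \<subseteq> V \<and> V - J \<notin> K"
  by (simp add: alexander_dual_def)

lemma dual_dual: "alexander_dual m K' = K"
  using sub by (auto simp: alexander_dual_def double_diff)

lemma empty_in_dual: "{} \<in> K'"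
  using V_notin by (simp add: dual_iff)

lemma nonfull_complex_dual: "nonfull_complex m K'"
proof
  show "simplicial_complex_on m K'"
    unfolding simplicial_complex_on_def
  proof (intro conjI ballI allI impI)
    fix F G assume "F \<in> K'" "G \<subseteq> F"
    then show "G \<in> K'" using down[of "V - G" "V - F"] by (auto simp: dual_iff)
  next
    show "K' \<noteq> {}" using empty_in_dual by blast
  qed (simp add: dual_iff)
  have "V \<notin> K'" using empty_in by (simp add: dual_iff)
  then show "K' \<noteq> Pow V" by blast
qed

lemma adj_Inl [simp]: "adj (bier m K) (Inl i) (Inl j) \<longleftrightarrow> i \<noteq> j \<and> {i, j} \<in> K"
proof -
  have "Inl -` {Inl i, Inl j :: nat + nat} = {i, j}" "Inr -` {Inl i, Inl j :: nat + nat} = {}" by auto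
  then show ?thesis using empty_in_dual by (simp add: adj_def bier_iff)
qed

lemma adj_Inr [simp]: "adj (bier m K) (Inr i) (Inr j) \<longleftrightarrow> i \<noteq> j \<and> {i, j} \<in> K'"
proof -
  have "Inr -` {Inr i, Inr j :: nat + nat} = {i, j}" "Inl -` {Inr i, Inr j :: nat + nat} = {}" by auto
  then show ?thesis using empty_in by (simp add: adj_def bier_iff)
qed

lemma adj_Inl_Inr [simp]: "adj (bier m K) (Inl i) (Inr j) \<longleftrightarrow> i \<noteq> j \<and> {i} \<in> K \<and> {j} \<in> K'"
proof -
  have "Inl -` {Inl i, Inr j} = {i}" "Inr -` {Inl i, Inr j} = {j}" by auto
  then show ?thesis by (auto simp: adj_def bier_iff)
qed

lemma adj_Inr_Inl [simp]: "adj (bier m K) (Inr j) (Inl i) \<longleftrightarrow> i \<noteq> j \<and> {i} \<in> K \<and> {j} \<in> K'"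
  using adj_sym adj_Inl_Inr by metis

lemma simplicial_iso_bier_dual: "simplicial_iso (bier m K) (bier m K')"
proof -
  define s :: "nat + nat \<Rightarrow> nat + nat" where "s = case_sum Inr Inl"
  have ss: "s (s x) = x" for x by (cases x) (auto simp: s_def)
  then have inj: "inj s" by (metis injI)
  have vim: "Inl -` (s ` F) = Inr -` F" "Inr -` (s ` F) = Inl -` F" for F
  proof -
    have mem: "x \<in> s ` F \<longleftrightarrow> s x \<in> F" for x using ss by (metis image_iff)
    have "s (Inl i) = Inr i" "s (Inr i) = Inl i" for i by (simp_all add: s_def)
    then show "Inl -` (s ` F) = Inr -` F" "Inr -` (s ` F) = Inl -` F" unfolding vimage_def mem by simp_all
  qed
  have iff: "s ` F \<in> bier m K' \<longleftrightarrow> F \<in> bier m K" for F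
    unfolding bier_iff vim dual_dual by blast
  have "image s ` bier m K = bier m K'"
  proof (intro subset_antisym subsetI)
    fix F assume "F \<in> bier m K'"
    moreover have "F = s ` s ` F" by (simp add: image_comp ss o_def)
    ultimately show "F \<in> image s ` bier m K" using iff by (metis imageI)
  qed (use iff in auto)
  then show ?thesis using simplicial_iso_image[of s "bier m K"] inj by (metis inj_on_subset subset_UNIV)
qed

text \<open>In the cycle i, j', i', j the diagonals are the pairs i, i' and j, j'. They are never
  edges, because the two parts of a face are disjoint.\<close>

lemma chordal_edge:
  assumes chordal: "chordal_complex (bier m K)" and ij: "i \<noteq> j" "{i, j} \<in> K" "{i} \<in> K'" "{j} \<in> K'"
  shows "{i, j} \<notin> K'"
proof
  assume e: "{i, j} \<in> K'"
  have "{i} \<in> K" "{j} \<in> K" using down[OF ij(2)] by auto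
  then have "\<not> chordal_complex (bier m K)"
    using induced_four_cycle_not_chordal[of "bier m K" "Inl i" "Inr j" "Inr i" "Inl j"] ij e
    by (simp add: insert_commute)
  then show False using chordal by simp
qed

text \<open>The complement of any subset of \<open>{i, j}\<close> contains the ghost vertex
  \<open>g\<close> and so is not in \<open>K\<close>. Hence all these subsets lie in
  \<open>K'\<close>, and \<open>chordal_edge\<close> applies.\<close>

lemma ghost_no_edges:
  assumes chordal: "chordal_complex (bier m K)" and g: "g \<in> V" "{g} \<notin> K" and ij: "{i, j} \<in> K"
  shows "i = j"
proof (rule ccontr)
  assume "i \<noteq> j"
  have V: "i \<in> V" "j \<in> V" using sub[OF ij] by auto
  have "{i} \<in> K" "{j} \<in> K" using down[OF ij] by auto
  then have "g \<noteq> i" "g \<noteq> j" using g by auto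
  have "J \<in> K'" if "J \<subseteq> {i, j}" for J
  proof -
    have "g \<in> V - J" using that g \<open>g \<noteq> i\<close> \<open>g \<noteq> j\<close> by auto
    then have "V - J \<notin> K" using down[of "V - J" "{g}"] g(2) by blast
    then show ?thesis using that V by (auto simp: dual_iff)
  qed
  then have "{i} \<in> K'" "{j} \<in> K'" "{i, j} \<in> K'" by auto
  then show False using chordal_edge[OF chordal \<open>i \<noteq> j\<close> ij] by blast
qed

text \<open>By \<open>chordal_edge\<close> the pair \<open>{i, j}\<close> is not in
  \<open>K'\<close>, which says that its complement is a face of \<open>K\<close>; that face
  contains every disjoint pair.\<close>

lemma chordal_disjoint_pairs:
  assumes chordal: "chordal_complex (bier m K)" and full: "\<forall>i\<in>V. {i} \<in> K'"
    and ij: "i \<noteq> j" "{i, j} \<in> K" and kl: "k \<in> V" "l \<in> V" "{i, j} \<inter> {k, l} = {}"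
  shows "{k, l} \<in> K"
proof -
  have V: "i \<in> V" "j \<in> V" using sub[OF ij(2)] by auto
  then have "{i, j} \<notin> K'" using chordal_edge[OF chordal ij] full by blast
  then have "V - {i, j} \<in> K" using V by (simp add: dual_iff)
  then show ?thesis using down kl by (metis Diff_iff disjoint_iff empty_subsetI insert_iff insert_subset)
qed

text \<open>The pairs in \<^term>\<open>K\<close> are closed under passing to disjoint pairs. For \<open>m \<ge> 5\<close> the disjointness
  graph on pairs is connected; for \<open>m = 4\<close> it has three components, and if neither all nor
  none of them belong to \<^term>\<open>K\<close> there is an induced 4-cycle in \<^term>\<open>K\<close> or in its dual.\<close>
lemma chordal_all_edges:
  assumes chordal: "chordal_complex (bier m K)" and m: "m \<ge> 4"
    and full: "\<forall>i\<in>V. {i} \<in> K" "\<forall>i\<in>V. {i} \<in> K'"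
    and ij: "i \<noteq> j" "{i, j} \<in> K" and l: "l \<in> V"
  shows "{i, l} \<in> K"
proof (rule ccontr)
  assume il: "{i, l} \<notin> K"
  have V: "i \<in> V" "j \<in> V" using sub[OF ij(2)] by auto
  then have neq: "i \<noteq> l" "j \<noteq> l" using il full ij(2) by auto
  note step = chordal_disjoint_pairs[OF chordal full(2)]
  have "card (V - {i, j, l}) = m - 3" using V l neq ij(1) by (simp add: card_Diff_subset)
  then have "card (V - {i, j, l}) > 0" using m by simp
  then obtain p where p: "p \<in> V - {i, j, l}" by (metis card_gt_0_iff ex_in_conv)
  show False
  proof (cases "m = 4")
    case False
    \<comment> \<open>With a fifth element \<open>q\<close> the pairs \<open>{i, j}\<close>,
      \<open>{p, q}\<close>, \<open>{i, l}\<close> form a path of disjoint pairs.\<close>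
    have "card (V - {i, j, l, p}) = m - 4" using V l neq ij(1) p by (simp add: card_Diff_subset)
    then have "card (V - {i, j, l, p}) > 0" using m False by simp
    then obtain q where q: "q \<in> V - {i, j, l, p}" by (metis card_gt_0_iff ex_in_conv)
    have "{p, q} \<in> K" using step[OF ij, of p q] p q by auto
    then show False using step[of p q i l] p q V l il by auto
  next
    case True
    then have "V = {i, j, l, p}"
      using V l neq ij(1) p by (intro card_seteq[symmetric]) auto
    then have compl: "V - {i, j} = {l, p}" "V - {i, l} = {j, p}" "V - {i, p} = {j, l}"
       "V - {j, p} = {i, l}" "V - {j, l} = {i, p}" "V - {l, p} = {i, j}"
      using neq ij(1) p by auto
    have pV: "p \<in> V" using p by blast
    have lp: "{l, p} \<in> K" using step[OF ij, of l p] p l neq by auto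
    have jp: "{j, p} \<notin> K" using step[of j p i l] p V l neq ij(1) il by auto
    have dual: "{x, y} \<in> K' \<longleftrightarrow> V - {x, y} \<notin> K" if "x \<in> V" "y \<in> V" for x y
      using that by (simp add: dual_iff)
    have D: "{i, l} \<in> K'" "{j, p} \<in> K'" "{i, j} \<notin> K'" "{l, p} \<notin> K'"
      using dual[OF V(1) l] dual[OF V(2) pV] dual[OF V] dual[OF l pV] jp il lp ij(2)
      unfolding compl by blast+
    \<comment> \<open>Of the three splittings of \<open>V\<close> into two pairs, ij and lp are in
      \<open>K\<close>, il and jp are not. If ip and jl are in \<open>K\<close>, then i, j, l, p is
      an induced cycle in \<open>K\<close>. If not, complementation puts il, jp, ip, jl into
      \<open>K'\<close>, and i', l', j', p' is one there.\<close>
    have "\<not> chordal_complex (bier m K)"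
    proof (cases "{i, p} \<in> K")
      case True
      then have "{j, l} \<in> K" using step[of i p j l] p V l neq ij(1) by auto
      then show ?thesis
        using induced_four_cycle_not_chordal[of "bier m K" "Inl i" "Inl j" "Inl l" "Inl p"]
          ij lp jp il True neq p by (simp add: insert_commute)
    next
      case False
      then have "{j, l} \<notin> K" using step[of j l i p] p V l neq ij(1) by auto
      then have "{i, p} \<in> K'" "{j, l} \<in> K'"
        using False dual[OF V(1) pV] dual[OF V(2) l] unfolding compl by blast+
      then show ?thesis
        using induced_four_cycle_not_chordal[of "bier m K" "Inr i" "Inr l" "Inr j" "Inr p"]
          D neq p ij(1) by (simp add: insert_commute)
    qed
    then show False using chordal by simp
  qed
qed

text \<open>If both complexes had edges, neither would have ghost vertices. For
  \<open>m \<ge> 4\<close> an edge of \<open>K\<close> then spreads to all pairs, among them an edge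
  of \<open>K'\<close>, which \<open>chordal_edge\<close> forbids.\<close>

lemma chordal_no_edges:
  assumes chordal: "chordal_complex (bier m K)" and m: "m \<ge> 3"
  shows "(\<forall>i j. {i, j} \<in> K \<longrightarrow> i = j) \<or> (\<forall>i j. {i, j} \<in> K' \<longrightarrow> i = j)"
proof (rule ccontr)
  assume "\<not> ?thesis"
  then obtain i j k l where ij: "{i, j} \<in> K" "i \<noteq> j" and kl: "{k, l} \<in> K'" "k \<noteq> l" by blast
  interpret dual: nonfull_complex m K' by (rule nonfull_complex_dual)
  have "simplicial_iso (bier m K') (bier m K)"
    using simplicial_iso_bier_dual by (rule simplicial_iso_sym)
  then have chordal': "chordal_complex (bier m K')" using chordal by (rule chordal_simplicial_iso)
  have full: "\<forall>x\<in>V. {x} \<in> K" "\<forall>x\<in>V. {x} \<in> K'"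
    using ghost_no_edges[OF chordal] dual.ghost_no_edges[OF chordal'] ij kl by blast+
  have V: "i \<in> V" "j \<in> V" "k \<in> V" "l \<in> V" using sub[OF ij(1)] dual.sub[OF kl(1)] by auto
  have "V - {k, l} \<notin> K" using kl(1) by (simp add: dual_iff)
  \<comment> \<open>For \<open>m = 3\<close> the complement of an edge of \<open>K'\<close> is a
    single vertex, hence in \<open>K\<close>.\<close>
  have "m \<noteq> 3"
  proof
    assume "m = 3"
    then have "card (V - {k, l}) = 1" using V kl(2) by (simp add: card_Diff_subset)
    then obtain r where "V - {k, l} = {r}" by (auto simp: card_1_singleton_iff)
    then show False using full(1) \<open>V - {k, l} \<notin> K\<close> by auto
  qed
  then have m4: "m \<ge> 4" using m by simp
  note star = chordal_all_edges[OF chordal m4 full]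
  have "{i, k} \<in> K" using star[OF ij(2,1) V(3)] .
  then have "{k, l} \<in> K"
  proof (cases "i = k")
    case True
    then show ?thesis using star[OF ij(2,1) V(4)] by simp
  next
    case False
    then show ?thesis using star[of k i l] \<open>{i, k} \<in> K\<close> V(4) by (simp add: insert_commute)
  qed
  then show False using chordal_edge[OF chordal kl(2)] full(2) V kl(1) by blast
qed

end

section \<open>Complexes consisting of points\<close>

definition points_complex :: "nat set \<Rightarrow> nat set set" where
  "points_complex A = insert {} ((\<lambda>i. {i}) ` A)"

lemma singleton_in_points [simp]: "{i} \<in> points_complex A \<longleftrightarrow> i \<in> A"
  by (auto simp: points_complex_def)

lemma pair_in_points: "{i, j} \<in> points_complex A \<longleftrightarrow> i = j \<and> i \<in> A"
  by (auto simp: points_complex_def)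

lemma card_points: "F \<in> points_complex A \<Longrightarrow> card F \<le> 1"
  by (auto simp: points_complex_def)

lemma nonfull_points_complex:
  assumes "A \<subseteq> {1..m}" "m \<ge> 2"
  shows "nonfull_complex m (points_complex A)"
proof
  show "simplicial_complex_on m (points_complex A)"
    using assms by (auto simp: simplicial_complex_on_def points_complex_def subset_singleton_iff)
  have "{1..m} \<notin> points_complex A" using card_points[of "{1..m}" A] assms by auto
  then show "points_complex A \<noteq> Pow {1..m}" by blast
qed

lemma (in nonfull_complex) no_edges_points_complex:
  assumes "\<forall>i j. {i, j} \<in> K \<longrightarrow> i = j"
  shows "\<exists>A\<subseteq>V. K = points_complex A"
proof (intro exI conjI)
  show "{i. {i} \<in> K} \<subseteq> V" using sub by blast
  show "K = points_complex {i. {i} \<in> K}"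
  proof (intro subset_antisym subsetI)
    fix F assume F: "F \<in> K"
    show "F \<in> points_complex {i. {i} \<in> K}"
    proof (cases "F = {}")
      case True then show ?thesis by (simp add: points_complex_def)
    next
      case False
      then obtain i where i: "i \<in> F" by blast
      have "j = i" if "j \<in> F" for j
        using assms down[OF F, of "{j, i}"] i that by auto
      then have "F = {i}" using i by blast
      then show ?thesis using F by simp
    qed
  qed (use empty_in in \<open>auto simp: points_complex_def\<close>)
qed

text \<open>The dual of the complex whose only face is empty consists of all proper subsets, which
  gives the boundary of a simplex as starting point for stacking.\<close>

lemma bier_points_empty:
  "bier m (points_complex {}) = Pow (Inr ` {1..m}) - {Inr ` {1..m}}"
proof (rule set_eqI)
  fix F :: "(nat + nat) set"
  have dual: "alexander_dual m (points_complex {}) = Pow {1..m} - {{1..m}}"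
    by (auto simp: alexander_dual_def points_complex_def)
  have "F \<subseteq> Inr ` {1..m} \<longleftrightarrow> Inl -` F = {} \<and> Inr -` F \<subseteq> {1..m}"
  proof
    assume R: "Inl -` F = {} \<and> Inr -` F \<subseteq> {1..m}"
    show "F \<subseteq> Inr ` {1..m}"
    proof
      fix x assume "x \<in> F" then show "x \<in> Inr ` {1..m}" using R by (cases x) auto
    qed
  qed auto
  moreover have "F = Inr ` {1..m} \<longleftrightarrow> Inr -` F = {1..m}" if "F \<subseteq> Inr ` {1..m}"
    using that by blast
  ultimately show "F \<in> bier m (points_complex {}) \<longleftrightarrow> F \<in> Pow (Inr ` {1..m}) - {Inr ` {1..m}}"
    unfolding bier_iff dual by (auto simp: points_complex_def)
qed

text \<open>Making the ghost vertex \<open>i\<close> a point removes exactly \<open>V - {i}\<close>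
  from the dual, and in the sphere this set occurs only with empty unprimed part. The gained faces
  have unprimed part \<open>{i}\<close>, joined with every proper subset of
  \<open>V - {i}\<close>.\<close>

lemma (in nonfull_complex) bier_insert_point:
  assumes i: "i \<in> V" "{i} \<notin> K"
  shows "bier m (insert {i} K) = stacked (Inl i) (Inr ` (V - {i})) (bier m K)"
proof (rule set_eqI)
  fix F :: "(nat + nat) set"
  define L where "L = Inl -` F"
  define R where "R = Inr -` F"
  have F_iff: "F = Inl ` X \<union> Inr ` Y \<longleftrightarrow> L = X \<and> R = Y" for X Y
  proof
    assume "L = X \<and> R = Y"
    moreover have "x \<in> F \<longleftrightarrow> x \<in> Inl ` L \<union> Inr ` R" for x
      by (cases x) (auto simp: L_def R_def)
    ultimately show "F = Inl ` X \<union> Inr ` Y" by blast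
  qed (auto simp: L_def R_def)
  have dual': "R \<in> alexander_dual m (insert {i} K) \<longleftrightarrow> R \<in> K' \<and> R \<noteq> V - {i}"
    using i(1) by (auto simp: alexander_dual_def)
  have top: "F = Inr ` (V - {i}) \<longleftrightarrow> L = {} \<and> R = V - {i}"
    using F_iff[of "{}" "V - {i}"] by simp
  have new: "(\<exists>S. F = insert (Inl i) S \<and> S \<subset> Inr ` (V - {i})) \<longleftrightarrow> L = {i} \<and> R \<subset> V - {i}"
  proof
    assume "\<exists>S. F = insert (Inl i) S \<and> S \<subset> Inr ` (V - {i})"
    then obtain S where S: "F = insert (Inl i) S" "S \<subset> Inr ` (V - {i})" by blast
    obtain Y where Y: "Y \<subseteq> V - {i}" "S = Inr ` Y" using S(2) by (metis psubsetE subset_image_iff)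
    then have "F = Inl ` {i} \<union> Inr ` Y" using S by simp
    then have LR: "L = {i} \<and> R = Y" by (simp only: F_iff)
    have "Y \<noteq> V - {i}" using S(2) Y(2) by blast
    then show "L = {i} \<and> R \<subset> V - {i}" using Y(1) LR by blast
  next
    assume LR: "L = {i} \<and> R \<subset> V - {i}"
    then have "F = insert (Inl i) (Inr ` R)" using F_iff[of "{i}" R] by simp
    moreover have "(Inr ` R :: (nat + nat) set) \<subset> Inr ` (V - {i})"
      using LR by (simp add: image_strict_mono)
    ultimately show "\<exists>S. F = insert (Inl i) S \<and> S \<subset> Inr ` (V - {i})" by blast
  qed
  \<comment> \<open>The complement of \<open>R\<close> contains \<open>i\<close>, whose singleton is
    not in \<open>K\<close>.\<close>
  have nonpoint: "R \<in> K'" if "R \<subset> V - {i}"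
  proof -
    have "i \<in> V - R" using that i by blast
    then have "V - R \<notin> K" using down[of "V - R" "{i}"] i(2) by blast
    then show ?thesis using that by (auto simp: dual_iff)
  qed
  have "L = {}" if "L \<in> K" "R = V - {i}" "L \<inter> R = {}"
  proof -
    have "L \<subseteq> {i}" using sub[OF that(1)] that by blast
    then show ?thesis using that(1) i(2) by (metis subset_singletonD)
  qed
  moreover have "F \<in> stacked (Inl i) (Inr ` (V - {i})) (bier m K) \<longleftrightarrow>
      ((L \<in> K \<and> R \<in> K' \<and> L \<inter> R = {}) \<and> \<not> (L = {} \<and> R = V - {i})) \<or> L = {i} \<and> R \<subset> V - {i}"
    unfolding new[symmetric] top[symmetric] by (auto simp: stacked_def bier_iff L_def R_def)
  moreover have "F \<in> bier m (insert {i} K) \<longleftrightarrow>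
      (L = {i} \<or> L \<in> K) \<and> (R \<in> K' \<and> R \<noteq> V - {i}) \<and> L \<inter> R = {}"
    unfolding bier_iff L_def[symmetric] R_def[symmetric] dual' by blast
  moreover have "R \<subset> V - {i} \<longleftrightarrow> R \<in> K' \<and> R \<noteq> V - {i} \<and> {i} \<inter> R = {}"
    using nonpoint by (auto simp: dual_iff)
  ultimately show "F \<in> bier m (insert {i} K) \<longleftrightarrow> F \<in> stacked (Inl i) (Inr ` (V - {i})) (bier m K)"
    by blast
qed

text \<open>The primed part cannot grow to \<open>V\<close>, since the empty set is in
  \<open>K\<close>, and the unprimed part could only be \<open>{i}\<close>, a ghost. Maximality lets
  \<open>vertex_exists\<close> supply the vertex to be truncated.\<close>

lemma (in nonfull_complex) maximal_face_of_nonpoint: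
  assumes i: "i \<in> V" "{i} \<notin> K"
  shows "Inr ` (V - {i}) \<in> bier m K"
    and "S \<in> bier m K \<Longrightarrow> Inr ` (V - {i}) \<subseteq> S \<Longrightarrow> S = Inr ` (V - {i})"
proof -
  have vim: "Inl -` (Inr ` (V - {i}) :: (nat + nat) set) = {}" "Inr -` (Inr ` (V - {i}) :: (nat + nat) set) = V - {i}"
    by auto
  have "V - (V - {i}) = {i}" using i by blast
  then show "Inr ` (V - {i}) \<in> bier m K"
    using empty_in i unfolding bier_iff vim dual_iff by auto
  assume S: "S \<in> bier m K" "Inr ` (V - {i}) \<subseteq> S"
  then have L: "Inl -` S \<in> K" and R: "Inr -` S \<in> K'" and dis: "Inl -` S \<inter> Inr -` S = {}"
    by (simp_all add: bier_iff)
  have sup: "V - {i} \<subseteq> Inr -` S" using S(2) by blast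
  have "Inr -` S \<noteq> V" "Inr -` S \<subseteq> V" using R empty_in by (auto simp: dual_iff)
  then have Req: "Inr -` S = V - {i}" using sup by blast
  then have "Inl -` S \<subseteq> {i}" using dis sub[OF L] by blast
  then have Leq: "Inl -` S = {}" using L i(2) by (metis subset_singletonD)
  show "S = Inr ` (V - {i})"
  proof (rule set_eqI)
    show "x \<in> S \<longleftrightarrow> x \<in> Inr ` (V - {i})" for x
      using Leq Req by (cases x) blast+
  qed
qed

lemma full_dim_simplex_exists:
  "\<exists>Q :: 'a::euclidean_space set. int DIM('a) simplex Q"
proof -
  obtain B :: "'a set" where B: "\<not> affine_dependent B" "affine hull UNIV = affine hull B"
    using affine_basis_exists[of "UNIV :: 'a set"] by blast
  then have "int (card B) = aff_dim (UNIV :: 'a set) + 1" using aff_dim_unique by metis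
  then show ?thesis using simplex_convex_hull[of B "int DIM('a)"] B(1) by auto
qed

lemma truncated_simplex_bier:
  assumes A: "A \<subseteq> {1..m}" and m: "m \<ge> 2" "A \<noteq> {} \<longrightarrow> m \<ge> 3" and dim: "DIM('a::euclidean_space) = m - 1"
  shows "\<exists>(Q :: 'a set) I c d. vertex_truncation (m - 1) (card A) Q \<and> I = Inr ` {1..m} \<union> Inl ` A \<and>
           hpoly I c d = Q \<and> simple_hpoly I c d (bier m (points_complex A))"
proof -
  have "finite A" using A finite_subset by blast
  then show ?thesis using A m(2)
  proof (induction A rule: finite_induct)
    case empty
    obtain Q :: "'a set" where Q: "int (m - 1) simplex Q" using full_dim_simplex_exists dim by metis
    let ?I = "Inr ` {1..m} :: (nat + nat) set"
    have "card ?I = Suc (m - 1)" using m by (simp add: card_image)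
    then obtain c d where "hpoly ?I c d = Q" "simple_hpoly ?I c d (Pow ?I - {?I})"
      using simplex_hpoly[OF Q dim, of ?I] by auto
    then show ?case using vertex_truncation.base[OF Q] bier_points_empty by fastforce
  next
    case (insert i A)
    let ?V = "{1..m}"
    have i: "i \<in> ?V" "{i} \<notin> points_complex A" and m3: "m \<ge> 3" using insert by auto
    obtain Q :: "'a set" and I c d where Q: "vertex_truncation (m - 1) (card A) Q"
      and I: "I = Inr ` {1..m} \<union> Inl ` A" and rep: "hpoly I c d = Q"
      and hp: "simple_hpoly I c d (bier m (points_complex A))" using insert m3 by blast
    interpret simple_hpoly I c d "bier m (points_complex A)" by (fact hp)
    interpret K: nonfull_complex m "points_complex A"
      using insert m by (intro nonfull_points_complex) auto
    obtain v where v: "v extreme_point_of hpoly I c d" "tight I c d v = Inr ` (?V - {i})"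
      using vertex_exists[OF K.maximal_face_of_nonpoint[OF i]] by blast
    obtain a b where ab: "a \<bullet> v > b" "\<forall>w. w extreme_point_of hpoly I c d \<and> w \<noteq> v \<longrightarrow> a \<bullet> w < b"
      using truncating_halfspace_exists[OF v(1)] by blast
    have z: "Inl i \<notin> I" using insert I by auto
    have "card (tight I c d v) = m - 1" using i(1) unfolding v(2) by (simp add: card_image)
    then have card: "2 \<le> card (tight I c d v)" using m3 by simp
    have w: "\<And>w. w extreme_point_of hpoly I c d \<Longrightarrow> w \<noteq> v \<Longrightarrow> a \<bullet> w < b" using ab(2) by blast
    note tr = truncation[OF v(1) ab(1) w z card]
    have "insert {i} (points_complex A) = points_complex (insert i A)"
      by (auto simp: points_complex_def)
    then have st: "stacked (Inl i) (tight I c d v) (bier m (points_complex A)) = bier m (points_complex (insert i A))"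
      using K.bier_insert_point[OF i] v(2) by simp
    have "vertex_truncation (m - 1) (Suc (card A)) (Q \<inter> {x. a \<bullet> x \<le> b})"
      using vertex_truncation.step[OF Q _ ab(1)] v(1) ab(2) unfolding rep by blast
    moreover have "card (insert i A) = Suc (card A)" using insert by simp
    moreover have "insert (Inl i) I = Inr ` {1..m} \<union> Inl ` insert i A" using I by auto
    ultimately show ?case using tr rep unfolding st by metis
  qed
qed

text \<open>Here the sphere is a cycle of length \<open>3 + card A\<close>: the hexagon i, j', k,
  i', j, k' with the unprimed vertices outside \<open>A\<close> dropped.\<close>

lemma not_chordal_bier_points_3:
  assumes A: "A \<subseteq> {1..3}" "A \<noteq> {}"
  shows "\<not> chordal_complex (bier 3 (points_complex A))"
proof -
  interpret nonfull_complex 3 "points_complex A" using A by (intro nonfull_points_complex) auto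
  let ?B = "bier 3 (points_complex A)"
  \<comment> \<open>The labels are ordered so that \<open>A\<close> is \<open>{i}\<close>,
    \<open>{i, j}\<close> or \<open>{i, j, k}\<close>.\<close>
  have *: "\<not> chordal_complex ?B"
    if ijk: "{1..3} = {i, j, k}" "i \<noteq> j" "i \<noteq> k" "j \<noteq> k" and i: "i \<in> A" and jk: "k \<in> A \<longrightarrow> j \<in> A" for i j k
  proof -
    have compl: "{1..3} - {i} = {j, k}" "{1..3} - {j} = {i, k}" "{1..3} - {k} = {i, j}"
      "{1..3} - {i, j} = {k}" "{1..3} - {i, k} = {j}" "{1..3} - {j, k} = {i}"
      unfolding ijk(1) using ijk(2-4) by auto
    have mem: "{i, j} \<subseteq> {1..3}" "{i, k} \<subseteq> {1..3}" "{j, k} \<subseteq> {1..3}" "{i} \<subseteq> {1..3}" "{j} \<subseteq> {1..3}" "{k} \<subseteq> {1..3}"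
      unfolding ijk(1) by auto
    have d: "{i} \<in> K'" "{j} \<in> K'" "{k} \<in> K'"
      "{i, j} \<in> K' \<longleftrightarrow> k \<notin> A" "{i, k} \<in> K' \<longleftrightarrow> j \<notin> A" "{j, k} \<in> K' \<longleftrightarrow> i \<notin> A"
      unfolding dual_iff compl using mem ijk(2-4) by (simp_all add: pair_in_points)
    have d': "{j, i} \<in> K' \<longleftrightarrow> k \<notin> A" "{k, i} \<in> K' \<longleftrightarrow> j \<notin> A" "{k, j} \<in> K' \<longleftrightarrow> i \<notin> A"
      using d(4-6) by (simp_all add: insert_commute)
    note rules = pair_in_points d d' ijk(2-4) ijk(2-4)[symmetric] i
    consider "j \<notin> A" "k \<notin> A" | "j \<in> A" "k \<notin> A" | "j \<in> A" "k \<in> A" using jk by blast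
    then show ?thesis
    proof cases
      case 1
      then show ?thesis
        by (intro induced_four_cycle_not_chordal[of ?B "Inl i" "Inr j" "Inr i" "Inr k"]) (simp_all add: rules)
    next
      case 2
      then show ?thesis
        by (intro induced_five_cycle_not_chordal[of ?B "Inl i" "Inr j" "Inr i" "Inl j" "Inr k"]) (simp_all add: rules)
    next
      case 3
      then show ?thesis
        by (intro induced_six_cycle_not_chordal[of ?B "Inl i" "Inr j" "Inl k" "Inr i" "Inl j" "Inr k"]) (simp_all add: rules)
    qed
  qed
  obtain i where i: "i \<in> A" using A by blast
  obtain j k where jk: "{1..3} = {i, j, k}" "i \<noteq> j" "i \<noteq> k" "j \<noteq> k"
  proof -
    have "card ({1..3} - {i}) = 2" using i A(1) by (auto simp: card_Diff_subset)
    then obtain j k where "{1..3} - {i} = {j, k}" "j \<noteq> k" by (auto simp: card_2_iff)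
    then show ?thesis using i A(1) by (intro that[of j k]) auto
  qed
  show ?thesis
  proof (cases "j \<in> A")
    case True
    then show ?thesis using *[OF jk i] by blast
  next
    case False
    have "{1..3} = {i, k, j}" using jk(1) by (simp add: insert_commute)
    then show ?thesis using *[of i k j] jk i False by blast
  qed
qed

text \<open>For \<open>m = 2\<close> the dual contains \<open>{2}\<close> exactly when
  \<open>K\<close> omits \<open>{1}\<close>, and likewise with 1 and 2 exchanged. So exactly one of
  \<open>Inl 1\<close> and \<open>Inr 2\<close> is a vertex, and one of \<open>Inl 2\<close> and
  \<open>Inr 1\<close>: the sphere is two isolated points.\<close>

lemma bier_two:
  assumes "nonfull_complex 2 K"
  shows "\<exists>p q. p \<noteq> q \<and> bier 2 K = Pow {p, q} - {{p, q}}"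
proof -
  interpret nonfull_complex 2 K by fact
  have V: "{1..2::nat} = {1, 2}" by auto
  have V2: "{1, 2} \<notin> K" using V_notin V by simp
  have proper: "L = {} \<or> L = {1} \<or> L = {2}" if "L \<subseteq> {1, 2}" "L \<noteq> {1, 2}" for L :: "nat set"
    using that by blast
  have K_sub: "L \<in> K \<Longrightarrow> L = {} \<or> L = {1} \<or> L = {2}" for L
    using sub[of L] V2 proper[of L] unfolding V by metis
  have K_cases: "L \<in> K \<longleftrightarrow> L = {} \<or> L = {1} \<and> {1} \<in> K \<or> L = {2} \<and> {2} \<in> K" for L
    using K_sub[of L] empty_in by blast
  have comp: "{1, 2} - {1} = {2::nat}" "{1, 2} - {2} = {1::nat}" by auto
  have "R \<in> K' \<Longrightarrow> R = {} \<or> R = {1} \<or> R = {2}" for R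
    unfolding dual_iff V using empty_in proper[of R] by (metis Diff_cancel)
  moreover have "{1} \<in> K' \<longleftrightarrow> {2} \<notin> K" "{2} \<in> K' \<longleftrightarrow> {1} \<notin> K"
    unfolding dual_iff V comp by auto
  ultimately have K'_cases: "R \<in> K' \<longleftrightarrow> R = {} \<or> R = {1} \<and> {2} \<notin> K \<or> R = {2} \<and> {1} \<notin> K" for R
    using empty_in_dual by blast
  define p :: "nat + nat" where "p = (if {1} \<in> K then Inl 1 else Inr 2)"
  define q :: "nat + nat" where "q = (if {2} \<in> K then Inl 2 else Inr 1)"
  have pq: "p \<noteq> q" by (auto simp: p_def q_def)
  have "F \<in> bier 2 K \<longleftrightarrow> F = {} \<or> F = {p} \<or> F = {q}" for F
  proof -
    have F_iff: "F = Inl ` X \<union> Inr ` Y \<longleftrightarrow> Inl -` F = X \<and> Inr -` F = Y" for X Y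
    proof
      assume "Inl -` F = X \<and> Inr -` F = Y"
      moreover have "x \<in> F \<longleftrightarrow> x \<in> Inl ` (Inl -` F) \<union> Inr ` (Inr -` F)" for x
        by (cases x) auto
      ultimately show "F = Inl ` X \<union> Inr ` Y" by blast
    qed auto
    have s: "F = {} \<longleftrightarrow> Inl -` F = {} \<and> Inr -` F = {}"
      "F = {Inl x} \<longleftrightarrow> Inl -` F = {x} \<and> Inr -` F = {}" "F = {Inr x} \<longleftrightarrow> Inl -` F = {} \<and> Inr -` F = {x}" for x
      using F_iff[of "{}" "{}"] F_iff[of "{x}" "{}"] F_iff[of "{}" "{x}"] by auto
    show ?thesis
      unfolding bier_iff K_cases[of "Inl -` F"] K'_cases p_def q_def
      by (cases "{1} \<in> K"; cases "{2} \<in> K") (auto simp: s)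
  qed
  then have "bier 2 K = Pow {p, q} - {{p, q}}" using pq by auto
  then show ?thesis using pq by blast
qed

theorem mainTheorem15:
  fixes m :: nat and K :: "nat set set"
  assumes "m \<ge> 2"
    and "simplicial_complex_on m K"
    and "K \<noteq> Pow {1..m}"
    and "DIM('a::euclidean_space) = m - 1"
  shows "chordal_complex (bier m K) \<longleftrightarrow>
           polytopal TYPE('a) (bier m K) \<and>
           ((m = 2 \<and> (\<exists>Q :: 'a set. 1 simplex Q \<and> PK_equiv m K Q)) \<or>
            (m = 3 \<and> (\<exists>Q :: 'a set. 2 simplex Q \<and> PK_equiv m K Q)) \<or>
            (m \<ge> 4 \<and> (\<exists>k \<le> m. \<exists>Q :: 'a set. vertex_truncation (m - 1) k Q \<and> PK_equiv m K Q)))"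
proof -
  interpret nonfull_complex m K using assms(2,3) by unfold_locales
  let ?B = "bier m K"
  let ?cases = "(m = 2 \<and> (\<exists>Q :: 'a set. 1 simplex Q \<and> PK_equiv m K Q)) \<or>
    (m = 3 \<and> (\<exists>Q :: 'a set. 2 simplex Q \<and> PK_equiv m K Q)) \<or>
    (m \<ge> 4 \<and> (\<exists>k \<le> m. \<exists>Q :: 'a set. vertex_truncation (m - 1) k Q \<and> PK_equiv m K Q))"
  show ?thesis
  proof
    assume R: "polytopal TYPE('a) ?B \<and> ?cases"
    \<comment> \<open>A simplex of dimension \<open>m - 1\<close> has \<open>m \<le> 3\<close>
      facets, too few for a cycle of length 4.\<close>
    have small: "chordal_complex ?B"
      if m_le: "m \<le> 3" and Q: "int (m - 1) simplex Q" and PK: "PK_equiv m K Q" for Q :: "'a set"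
    proof -
      define I where "I = {1..m}"
      have I: "finite I" "card I = Suc (m - 1)" using assms(1) by (simp_all add: I_def)
      obtain c d where cd: "hpoly I c d = Q" "simple_hpoly I c d (Pow I - {I})"
        using simplex_hpoly[OF Q assms(4) I] by blast
      interpret simple_hpoly I c d "Pow I - {I}" by (fact cd(2))
      have "chordal_complex (Pow I - {I})"
        using I m_le by (intro chordal_few_vertices) (simp_all add: Union_D)
      moreover have "simplicial_iso ?B (Pow I - {I})"
        using PK simplicial_iso_dual_boundary simplicial_iso_trans simplicial_iso_sym
        unfolding PK_equiv_def cd(1) by blast
      ultimately show ?thesis using chordal_simplicial_iso by blast
    qed
    from R consider
        Q :: "'a set" where "m = 2" "1 simplex Q" "PK_equiv m K Q"
      | Q :: "'a set" where "m = 3" "2 simplex Q" "PK_equiv m K Q"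
      | k and Q :: "'a set" where "m \<ge> 4" "vertex_truncation (m - 1) k Q" "PK_equiv m K Q"
      by blast
    then show "chordal_complex ?B"
    proof cases
      case 1
      then show ?thesis using small[of Q] by simp
    next
      case 2
      then show ?thesis using small[of Q] by simp
    next
      case 3
      then have "m - 1 \<ge> 3" by simp
      then obtain I :: "nat set" and c d D where rep: "hpoly I c d = Q" "simple_hpoly I c d D"
        and D: "chordal_complex D"
        using vertex_truncation_chordal[OF 3(2) assms(4)] by metis
      interpret simple_hpoly I c d D by (fact rep(2))
      have "simplicial_iso ?B D"
        using 3(3) simplicial_iso_dual_boundary simplicial_iso_trans simplicial_iso_sym
        unfolding PK_equiv_def rep(1) by blast
      then show ?thesis using chordal_simplicial_iso D by blast
    qed
  next
    assume chordal: "chordal_complex ?B"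
    \<comment> \<open>One inequality system yields both claims: its polar dual gives polytopality,
      the polytope itself is a candidate for \<open>P_K\<close>.\<close>
    have realize: "polytopal TYPE('a) ?B \<and> PK_equiv m K Q"
      if rep: "hpoly I c d = Q" "simple_hpoly I c d D" and iso: "simplicial_iso ?B D"
      for Q :: "'a set" and I :: "(nat + nat) set" and c d D
    proof -
      interpret simple_hpoly I c d D by (fact rep(2))
      show ?thesis
        using polytopal_simplicial_iso[OF polytopal_D iso] polytope
          simplicial_iso_trans[OF iso simplicial_iso_dual_boundary]
        unfolding PK_equiv_def rep(1) by blast
    qed
    show "polytopal TYPE('a) ?B \<and> ?cases"
    proof (cases "m = 2")
      case True
      have "nonfull_complex 2 K" using nonfull_complex_axioms unfolding True .
      then obtain p q where pq: "p \<noteq> q" "?B = Pow {p, q} - {{p, q}}" using bier_two True by blast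
      obtain Q :: "'a set" where Q: "int (m - 1) simplex Q" using full_dim_simplex_exists assms(4) by metis
      obtain c d where "hpoly {p, q} c d = Q" "simple_hpoly {p, q} c d ?B"
        using simplex_hpoly[OF Q assms(4), of "{p, q}"] pq True by auto
      moreover have "simplicial_iso ?B ?B" using simplicial_iso_image[of id ?B] by simp
      ultimately show ?thesis using realize Q True by auto
    next
      case False
      then have m3: "m \<ge> 3" using assms(1) by simp
      interpret dual: nonfull_complex m K' by (rule nonfull_complex_dual)
      have "simplicial_iso ?B ?B" using simplicial_iso_image[of id ?B] by simp
      then obtain A where A: "A \<subseteq> V" "simplicial_iso ?B (bier m (points_complex A))"
        using chordal_no_edges[OF chordal m3] no_edges_points_complex dual.no_edges_points_complex
          simplicial_iso_bier_dual by metis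
      obtain Q :: "'a set" and I c d where Q: "vertex_truncation (m - 1) (card A) Q" "hpoly I c d = Q"
        "simple_hpoly I c d (bier m (points_complex A))"
        using truncated_simplex_bier[OF A(1) assms(1) _ assms(4)] m3 by blast
      have PK: "polytopal TYPE('a) ?B" "PK_equiv m K Q" using realize[OF Q(2,3) A(2)] by auto
      show ?thesis
      proof (cases "m = 3")
        case True
        have "chordal_complex (bier m (points_complex A))"
          using chordal simplicial_iso_sym[OF A(2)] chordal_simplicial_iso by blast
        \<comment> \<open>A truncated triangle has at least four sides, so its dual is an induced
          cycle; hence nothing has been cut.\<close>
        then have "A = {}" using not_chordal_bier_points_3 A(1) True by blast
        then have "int (m - 1) simplex Q" using Q(1) by (auto elim: vertex_truncation.cases)
        then show ?thesis using PK True by auto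
      next
        case False
        have "card A \<le> m" using A(1) card_mono[of V A] by simp
        then show ?thesis using PK Q(1) False m3 by auto
      qed
    qed
  qed
qed

end
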